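(* Let $p>6$. There exist a bounded, measurable and strictly accretive function $a:\mathbb{R}^2\to\mathbb{C}$ and a solution $u$ of $$\partial_t u-\partial_x\bigl(a(t,x)\,\partial_x u\bigr)=0\quad\text{in }\mathbb{R}^2$$ such that for every $\varepsilon\in(0,1)$, $$\|u\|_{\mathrm{L}^p(Q_\varepsilon(0,0))}=\infty .$$
   Context: Functions are complex-valued; points of $\mathbb{R}^2$ are written $(t,x)$ with $t$ time and $x$ space. A function $a$ is strictly accretive if there is a constant $\lambda>0$ such that $\operatorname{Re}(a)\ge\lambda$ almost everywhere on its domain. For $r>0$ and $(t_0,x_0)\in\mathbb{R}^2$, the backward-in-time parabolic cylinder is $Q_r(t_0,x_0):=(t_0-r^2,t_0)\times(x_0-r,x_0+r)$. A solution $u$ of the equation in $Q_r(t_0,x_0)$ is a function $u\in \mathrm{L}^2(Q_r(t_0,x_0))$ such that the distributional derivative $\partial_x u$ belongs to $\mathrm{L}^2(Q_r(t_0,x_0))$ and the equation $\partial_t u-\partial_x(a\,\partial_x u)=0$ holds in $Q_r(t_0,x_0)$ in the sense of distributions. A solution in $\mathbb{R}^2$ is a function that is a solution in every cylinder $Q_r(t_0,x_0)\subset\mathbb{R}^2$. The statement $\|u\|_{\mathrm{L}^p(Q_\varepsilon(0,0))}=\infty$ means $\int_{Q_\varepsilon(0,0)}|u|^p\,\mathrm{d}t\,\mathrm{d}x=\infty$. *)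

theory Defs
  imports "HOL-Analysis.Analysis"
begin

text \<open>Points of the plane are pairs \<open>(t, x)\<close> of type \<open>real \<times> real\<close>, time first.\<close>

definition par_cyl :: "real \<Rightarrow> real \<Rightarrow> real \<Rightarrow> (real \<times> real) set" where
  "par_cyl r t0 x0 = {t0 - r\<^sup>2 <..< t0} \<times> {x0 - r <..< x0 + r}"

definition strictly_accretive :: "(real \<times> real \<Rightarrow> complex) \<Rightarrow> bool" where
  "strictly_accretive a \<longleftrightarrow> (\<exists>c>0. AE z in lebesgue. c \<le> Re (a z))"

definition square_integrable_on :: "(real \<times> real \<Rightarrow> complex) \<Rightarrow> (real \<times> real) set \<Rightarrow> bool" where
  "square_integrable_on f \<Omega> \<longleftrightarrow>
     set_borel_measurable lebesgue \<Omega> f \<and> set_integrable lebesgue \<Omega> (\<lambda>z. (cmod (f z))\<^sup>2)"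


subsection \<open>Test functions\<close>

definition partial_t :: "(real \<times> real \<Rightarrow> complex) \<Rightarrow> real \<times> real \<Rightarrow> complex" where
  "partial_t \<phi> z = frechet_derivative \<phi> (at z) (1, 0)"

definition partial_x :: "(real \<times> real \<Rightarrow> complex) \<Rightarrow> real \<times> real \<Rightarrow> complex" where
  "partial_x \<phi> z = frechet_derivative \<phi> (at z) (0, 1)"

primrec C_times :: "nat \<Rightarrow> (real \<times> real \<Rightarrow> complex) \<Rightarrow> bool" where
  "C_times 0 \<phi> \<longleftrightarrow> continuous_on UNIV \<phi>"
| "C_times (Suc k) \<phi> \<longleftrightarrow>
     (\<forall>z. \<phi> differentiable (at z)) \<and> C_times k (partial_t \<phi>) \<and> C_times k (partial_x \<phi>)"

definition test_functions :: "(real \<times> real) set \<Rightarrow> (real \<times> real \<Rightarrow> complex) set" where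
  "test_functions \<Omega> =
     {\<phi>. (\<forall>k. C_times k \<phi>) \<and> compact (closure {z. \<phi> z \<noteq> 0}) \<and> closure {z. \<phi> z \<noteq> 0} \<subseteq> \<Omega>}"


subsection \<open>Distributions\<close>

text \<open>
  Distributions on \<open>\<Omega>\<close> are represented by the functionals \<open>T\<close> giving their pairing (bilinear, without
  complex conjugation) with test functions; only the values on \<open>test_functions \<Omega>\<close> are meaningful,
  so equality of distributions on \<open>\<Omega>\<close> is equality there. For bounded
  measurable \<open>a\<close>, every functional below comes from integrable functions and is hence continuous, so
  continuity is not part of the encoding.
\<close>

type_synonym distr = "(real \<times> real \<Rightarrow> complex) \<Rightarrow> complex"

definition distr_of :: "(real \<times> real) set \<Rightarrow> (real \<times> real \<Rightarrow> complex) \<Rightarrow> distr" where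
  "distr_of \<Omega> f \<phi> = (LINT z:\<Omega>|lebesgue. f z * \<phi> z)"

definition distr_dt :: "distr \<Rightarrow> distr" where
  "distr_dt T \<phi> = - T (partial_t \<phi>)"

definition distr_dx :: "distr \<Rightarrow> distr" where
  "distr_dx T \<phi> = - T (partial_x \<phi>)"

definition distr_eq_on :: "(real \<times> real) set \<Rightarrow> distr \<Rightarrow> distr \<Rightarrow> bool" where
  "distr_eq_on \<Omega> S T \<longleftrightarrow> (\<forall>\<phi>\<in>test_functions \<Omega>. S \<phi> = T \<phi>)"


subsection \<open>Solutions of \<open>\<partial>\<^sub>t u - \<partial>\<^sub>x (a \<partial>\<^sub>x u) = 0\<close>\<close>

text \<open>The function \<open>v\<close> represents the distributional derivative \<open>\<partial>\<^sub>x u\<close>, which is thereby required to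
  lie in \<open>L\<^sup>2\<close>; it is unique up to null sets.\<close>

definition solution_in_cyl ::
  "(real \<times> real \<Rightarrow> complex) \<Rightarrow> (real \<times> real \<Rightarrow> complex) \<Rightarrow> real \<Rightarrow> real \<Rightarrow> real \<Rightarrow> bool" where
  "solution_in_cyl a u r t0 x0 \<longleftrightarrow>
     (let Q = par_cyl r t0 x0 in
        square_integrable_on u Q \<and>
        (\<exists>v. square_integrable_on v Q \<and>
             distr_eq_on Q (distr_dx (distr_of Q u)) (distr_of Q v) \<and>
             distr_eq_on Q
               (\<lambda>\<phi>. distr_dt (distr_of Q u) \<phi> - distr_dx (distr_of Q (\<lambda>z. a z * v z)) \<phi>)
               (\<lambda>\<phi>. 0)))"

definition solution_in_plane ::
  "(real \<times> real \<Rightarrow> complex) \<Rightarrow> (real \<times> real \<Rightarrow> complex) \<Rightarrow> bool" where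
  "solution_in_plane a u \<longleftrightarrow> (\<forall>r>0. \<forall>t0 x0. solution_in_cyl a u r t0 x0)"

end

theory Submission
  imports Defs
begin

text \<open>
  If \<open>\<partial>\<^sub>tw = a \<partial>\<^sub>x\<^sup>2w\<close>, then \<open>u = \<partial>\<^sub>xw\<close> solves the equation in divergence form. For self-similar
  \<open>w (t, x) = \<bar>t\<bar> powr (\<gamma>/2) * h (x / sqrt \<bar>t\<bar>)\<close> this only asks that \<open>(y h' - \<gamma> h) / (2 h'')\<close> (for \<open>t < 0\<close>;
  its negative for \<open>t > 0\<close>) is bounded with real part bounded below by a positive constant. The derivative
  \<open>\<partial>\<^sub>xu\<close> is locally square integrable as soon as \<open>\<gamma> > 1/2\<close>, while \<open>\<bar>u\<bar> powr p\<close> fails to be integrable at the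
  origin if \<open>p (1 - \<gamma>) = 3\<close>; the two are compatible exactly for \<open>p > 6\<close>. In the future a real profile
  will do. In the past the maximum principle forbids real profiles; for complex \<open>h\<close>
  the quantity \<open>Z = y h'/h - \<gamma>\<close> moves in the plane, and the constraint on \<open>a\<close> bounds from below only its
  radial logarithmic velocity, leaving the angular one free. Since \<open>\<gamma> > 1/2\<close>, \<open>Z\<close> can be turned
  from the positive to the negative half-axis, along which it may then tend to \<open>0\<close>.
\<close>

section \<open>Weak derivatives from derivatives along lines\<close>

text \<open>Scaling makes the squared norm of \<partial>_x u over a time slice a multiple of |t| to
  the power \<gamma> - 3/2, whence the threshold 1/2. The turn of Z is forced at both ends: h(y) ~ y
  at 0 makes Z start at 1 - \<gamma> > 0, and growth of h like |y| to the power \<gamma> makes Z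
  tend to 0. In the variable s = ln(y^2), accretivity in the past means Re N > 0 for N = 2 Z'/Z +
  \<delta> + Z - \<gamma>(1 - \<gamma>)/Z with \<delta> = 2\<gamma> - 1. For small positive Z the
  last term is very negative and could only be offset by growth of Z; for small negative Z it helps.
  The turn is affordable because on the circle |Z| = 1/2 the last two terms have real part
  (\<delta>^2/2) cos(arg Z), while a rotation has imaginary Z'/Z; so Re N stays at least \<delta> -
  \<delta>^2/2 > 0. Past and future interact only through the growth constant L of their profiles: a
  common L makes w continuous in time across t = 0 for x \<noteq> 0, so that \<partial>_t w carries
  no mass on that line.\<close>

lemma C_times_continuous: "C_times k \<phi> \<Longrightarrow> continuous_on UNIV \<phi>"
  by (cases k) (auto simp: continuous_on_eq_continuous_within differentiable_imp_continuous_within)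

lemma has_vector_derivative_partial_t:
  assumes "\<phi> differentiable (at (t, x))"
  shows "((\<lambda>s. \<phi> (s, x)) has_vector_derivative partial_t \<phi> (t, x)) (at t)"
proof -
  have "(\<phi> has_derivative frechet_derivative \<phi> (at (t, x))) (at (t, x))"
    using assms frechet_derivative_works by blast
  moreover have "((\<lambda>s. (s, x)) has_vector_derivative (1, 0)) (at t)"
    by (auto intro!: derivative_eq_intros has_vector_derivative_Pair)
  ultimately show ?thesis
    using vector_derivative_diff_chain_within[of "\<lambda>s. (s, x)" "(1, 0)" t UNIV \<phi>]
    by (simp add: partial_t_def o_def has_derivative_at_withinI)
qed

lemma has_vector_derivative_partial_x:
  assumes "\<phi> differentiable (at (t, x))"
  shows "((\<lambda>y. \<phi> (t, y)) has_vector_derivative partial_x \<phi> (t, x)) (at x)"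
proof -
  have "(\<phi> has_derivative frechet_derivative \<phi> (at (t, x))) (at (t, x))"
    using assms frechet_derivative_works by blast
  moreover have "((\<lambda>y. (t, y)) has_vector_derivative (0, 1)) (at x)"
    by (auto intro!: derivative_eq_intros has_vector_derivative_Pair)
  ultimately show ?thesis
    using vector_derivative_diff_chain_within[of "\<lambda>y. (t, y)" "(0, 1)" x UNIV \<phi>]
    by (simp add: partial_x_def o_def has_derivative_at_withinI)
qed

text \<open>Differentiating \<open>\<phi> (t, x) = \<phi> (t, x\<^sub>0) + (\<integral>y=x\<^sub>0..x. \<partial>\<^sub>x\<phi> (t, y))\<close> under the integral sign shows
  that \<open>\<partial>\<^sub>t\<partial>\<^sub>x\<phi>\<close> is the \<open>x\<close>-derivative of \<open>\<partial>\<^sub>t\<phi>\<close>.\<close>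
lemma mixed_partials_commute:
  assumes "C_times 2 \<phi>"
  shows "partial_x (partial_t \<phi>) = partial_t (partial_x \<phi>)"
proof
  fix z :: "real \<times> real"
  obtain t x where z: "z = (t, x)" by force
  from assms have diff: "\<phi> differentiable (at z)" "partial_t \<phi> differentiable (at z)"
      "partial_x \<phi> differentiable (at z)" for z
    by (simp_all add: numeral_2_eq_2 del: split_paired_All)
  have cont: "continuous_on UNIV (partial_x \<phi>)" "continuous_on UNIV (partial_t (partial_x \<phi>))"
    using assms C_times_continuous[of 1 "partial_x \<phi>"] by (simp_all add: numeral_2_eq_2)
  define x0 x1 where "x0 = x - 1" and "x1 = x + 1"
  have ftc: "\<phi> (s, y) = \<phi> (s, x0) + integral {x0..y} (\<lambda>\<xi>. partial_x \<phi> (s, \<xi>))" if "x0 \<le> y" for s y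
  proof -
    have "((\<lambda>\<xi>. partial_x \<phi> (s, \<xi>)) has_integral \<phi> (s, y) - \<phi> (s, x0)) {x0..y}"
      using that
      by (rule fundamental_theorem_of_calculus)
        (rule has_vector_derivative_at_within[OF has_vector_derivative_partial_x[OF diff(1)]])
    then show ?thesis by (simp add: integral_unique)
  qed
  have eq: "partial_t \<phi> (t, y) = partial_t \<phi> (t, x0)
      + integral {x0..y} (\<lambda>\<xi>. partial_t (partial_x \<phi>) (t, \<xi>))" if "x0 \<le> y" for y
  proof -
    have "((\<lambda>s. integral (cbox x0 y) (\<lambda>\<xi>. partial_x \<phi> (s, \<xi>))) has_vector_derivative
        integral (cbox x0 y) (\<lambda>\<xi>. partial_t (partial_x \<phi>) (t, \<xi>))) (at t within UNIV)"
    proof (rule leibniz_rule_vector_derivative)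
      show "((\<lambda>s. partial_x \<phi> (s, \<xi>)) has_vector_derivative partial_t (partial_x \<phi>) (s, \<xi>))
          (at s within UNIV)" for s \<xi>
        by (rule has_vector_derivative_partial_t[OF diff(3)])
      show "(\<lambda>\<xi>. partial_x \<phi> (s, \<xi>)) integrable_on cbox x0 y" for s
        by (rule integrable_continuous, rule continuous_on_compose2[OF cont(1)])
          (auto intro!: continuous_intros)
      show "continuous_on (UNIV \<times> cbox x0 y) (\<lambda>(s, \<xi>). partial_t (partial_x \<phi>) (s, \<xi>))"
        unfolding case_prod_beta prod.collapse
        by (rule continuous_on_subset[OF cont(2)]) auto
    qed simp_all
    then have "((\<lambda>s. \<phi> (s, x0) + integral {x0..y} (\<lambda>\<xi>. partial_x \<phi> (s, \<xi>))) has_vector_derivative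
        partial_t \<phi> (t, x0) + integral {x0..y} (\<lambda>\<xi>. partial_t (partial_x \<phi>) (t, \<xi>))) (at t)"
      unfolding cbox_interval
      by (rule has_vector_derivative_add[OF has_vector_derivative_partial_t[OF diff(1)]])
    then have "((\<lambda>s. \<phi> (s, y)) has_vector_derivative
        partial_t \<phi> (t, x0) + integral {x0..y} (\<lambda>\<xi>. partial_t (partial_x \<phi>) (t, \<xi>))) (at t)"
      unfolding ftc[OF that, symmetric] .
    then show ?thesis
      by (rule vector_derivative_unique_at[OF has_vector_derivative_partial_t[OF diff(1)]])
  qed
  have "((\<lambda>y. integral {x0..y} (\<lambda>\<xi>. partial_t (partial_x \<phi>) (t, \<xi>))) has_vector_derivative
      partial_t (partial_x \<phi>) (t, x)) (at x within {x0..x1})"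
    by (rule integral_has_vector_derivative)
      (auto simp: x0_def x1_def intro!: continuous_on_compose2[OF cont(2)] continuous_intros)
  from has_vector_derivative_add[OF has_vector_derivative_const this]
  have deriv: "((\<lambda>y. partial_t \<phi> (t, x0) + integral {x0..y} (\<lambda>\<xi>. partial_t (partial_x \<phi>) (t, \<xi>)))
      has_vector_derivative partial_t (partial_x \<phi>) (t, x)) (at x within {x0..x1})"
    unfolding add_0 .
  have "((\<lambda>y. partial_t \<phi> (t, y)) has_vector_derivative partial_t (partial_x \<phi>) (t, x))
      (at x within {x0..x1})"
    by (rule has_vector_derivative_transform[OF _ _ deriv]) (simp add: x0_def x1_def, rule eq, simp)
  then have "((\<lambda>y. partial_t \<phi> (t, y)) has_vector_derivative partial_t (partial_x \<phi>) (t, x)) (at x)"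
    using at_within_Icc_at[of x0 x x1] by (simp add: x0_def x1_def)
  then show "partial_x (partial_t \<phi>) z = partial_t (partial_x \<phi>) z"
    unfolding z by (rule vector_derivative_unique_at[OF has_vector_derivative_partial_x[OF diff(2)]])
qed

lemma test_functionsD:
  assumes "\<phi> \<in> test_functions \<Omega>"
  shows "C_times k \<phi>" "\<phi> differentiable (at z)" "continuous_on UNIV \<phi>"
proof -
  have C: "C_times k \<phi>" for k
    using assms unfolding test_functions_def by blast
  show "C_times k \<phi>" "\<phi> differentiable (at z)" "continuous_on UNIV \<phi>"
    using C[of k] C[of "Suc 0"] C_times_continuous[OF C[of 0]] by (simp_all del: split_paired_All)
qed

lemma frechet_derivative_outside_support:
  assumes "z \<notin> closure {z. \<phi> z \<noteq> 0}"
  shows "frechet_derivative \<phi> (at z) = (\<lambda>h. 0)"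
proof -
  have "(\<phi> has_derivative (\<lambda>h. 0)) (at z)"
  proof (rule has_derivative_transform_within_open)
    show "((\<lambda>_. 0) has_derivative (\<lambda>h. 0)) (at z)" by simp
    show "open (- closure {z. \<phi> z \<noteq> 0})" "z \<in> - closure {z. \<phi> z \<noteq> 0}" using assms by auto
    show "0 = \<phi> y" if "y \<in> - closure {z. \<phi> z \<noteq> 0}" for y
      using that closure_subset[of "{z. \<phi> z \<noteq> 0}"] by auto
  qed
  then show ?thesis
    using frechet_derivative_at by metis
qed

text \<open>The equation for \<open>u\<close> comes from testing identities for \<open>w\<close>
  against \<open>partial_t \<phi>\<close> and \<open>partial_x \<phi>\<close>, which must therefore
  be test functions again.\<close>

lemma test_functions_partial:
  assumes "\<phi> \<in> test_functions \<Omega>"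
  shows "partial_t \<phi> \<in> test_functions \<Omega>" "partial_x \<phi> \<in> test_functions \<Omega>"
proof -
  have "partial_t \<phi> z = 0" "partial_x \<phi> z = 0" if "z \<notin> closure {z. \<phi> z \<noteq> 0}" for z
    using frechet_derivative_outside_support[OF that] by (simp_all add: partial_t_def partial_x_def)
  then have sub: "closure {z. partial_t \<phi> z \<noteq> 0} \<subseteq> closure {z. \<phi> z \<noteq> 0}"
    "closure {z. partial_x \<phi> z \<noteq> 0} \<subseteq> closure {z. \<phi> z \<noteq> 0}"
    by (intro closure_minimal closed_closure subsetI; blast)+
  have C: "C_times (Suc k) \<phi>" for k
    using assms by (rule test_functionsD)
  have cpt: "compact (closure {z. \<phi> z \<noteq> 0})" "closure {z. \<phi> z \<noteq> 0} \<subseteq> \<Omega>"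
    using assms unfolding test_functions_def by blast+
  show "partial_t \<phi> \<in> test_functions \<Omega>" "partial_x \<phi> \<in> test_functions \<Omega>"
    using C cpt bounded_subset[OF _ order.trans[OF closure_subset sub(1)]]
      bounded_subset[OF _ order.trans[OF closure_subset sub(2)]]
      order.trans[OF sub(1) cpt(2)] order.trans[OF sub(2) cpt(2)]
    by (auto simp: test_functions_def)
qed

text \<open>Bounded support removes the boundary terms of the fundamental theorem, and continuity of
  \<open>g\<close> lets that theorem tolerate finitely many points without a derivative.\<close>

lemma lborel_integral_derivative_eq_0:
  fixes g g' :: "real \<Rightarrow> complex"
  assumes X: "finite X" and cont: "continuous_on UNIV g"
    and deriv: "\<And>x. x \<notin> X \<Longrightarrow> (g has_vector_derivative g' x) (at x)"
    and supp: "\<And>x. R < \<bar>x\<bar> \<Longrightarrow> g x = 0"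
  shows "(LINT x|lborel. g' x) = 0"
proof (cases "integrable lborel g'")
  case False
  \<comment> \<open>The integral of a non-integrable function is 0 by convention.\<close>
  then show ?thesis by (rule not_integrable_integral_eq)
next
  case True
  define r where "r = \<bar>R\<bar> + 1"
  \<comment> \<open>\<open>g'\<close> is arbitrary on \<open>X\<close>; resetting it to 0 there
    makes it vanish everywhere off the interval, so that the integral extends to the whole
    line.\<close>
  define g'' where "g'' = (\<lambda>x. if x \<in> X then 0 else g' x)"
  have "(g'' has_integral g r - g (- r)) {- r..r}"
    by (rule fundamental_theorem_of_calculus_strong[OF X])
      (auto simp: r_def g''_def intro!: deriv continuous_on_subset[OF cont])
  moreover have "g r = 0" "g (- r) = 0"
    by (auto simp: r_def intro!: supp)
  ultimately have "(g'' has_integral 0) {- r..r}" by simp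
  moreover have "g'' x = 0" if "x \<notin> {- r..r}" for x
  proof (cases "x \<in> X")
    case False
    have "(g has_vector_derivative 0) (at x)"
    proof (rule has_vector_derivative_transform_within_open)
      show "((\<lambda>_. 0) has_vector_derivative 0) (at x)" by simp
      show "open (- {- r..r})" "x \<in> - {- r..r}" using that by auto
      show "0 = g y" if "y \<in> - {- r..r}" for y
        using that by (intro supp[symmetric]) (auto simp: r_def)
    qed
    then show ?thesis
      using deriv[OF False] vector_derivative_unique_at False by (auto simp: g''_def)
  qed (simp add: g''_def)
  ultimately have "(g'' has_integral 0) UNIV"
    by (rule has_integral_on_superset) auto
  then have "(g' has_integral 0) UNIV"
    by (rule has_integral_spike_finite[OF X, rotated]) (auto simp: g''_def)
  then show ?thesis
    using has_integral_integral_lborel[OF True] has_integral_unique by blast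
qed

text \<open>On a set of finite measure, |f| \<le> 1 + |f|^2 turns square integrability into
  integrability, and \<open>\<phi>\<close> is bounded. Since \<open>\<phi>\<close> vanishes off
  \<open>\<Omega>\<close> and \<open>f\<close> is Borel, both the restriction to
  \<open>\<Omega>\<close> and the completion disappear from the pairing.\<close>

lemma integrable_mult_test_function:
  fixes f :: "real \<times> real \<Rightarrow> complex"
  assumes f: "f \<in> borel_measurable borel" and sq: "square_integrable_on f \<Omega>"
    and \<Omega>: "\<Omega> \<in> sets borel" "emeasure lborel \<Omega> < \<infinity>" and \<phi>: "\<phi> \<in> test_functions \<Omega>"
  shows "integrable lborel (\<lambda>z. f z * \<phi> z)"
    and "distr_of \<Omega> f \<phi> = (LINT z|lborel. f z * \<phi> z)"
proof -
  have cont: "continuous_on UNIV \<phi>" and cpt: "compact (closure {z. \<phi> z \<noteq> 0})"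
    and sub: "closure {z. \<phi> z \<noteq> 0} \<subseteq> \<Omega>"
    using test_functionsD(3)[OF \<phi>] \<phi> by (simp_all add: test_functions_def)
  have \<phi>_borel [measurable]: "\<phi> \<in> borel_measurable borel"
    using cont by (rule borel_measurable_continuous_onI)
  have out: "\<phi> z = 0" if "z \<notin> \<Omega>" for z
    using that sub closure_subset[of "{z. \<phi> z \<noteq> 0}"] by auto
  have "bounded (\<phi> ` closure {z. \<phi> z \<noteq> 0})"
    using cont cpt continuous_on_subset compact_continuous_image compact_imp_bounded by blast
  then obtain M where M: "M > 0" "\<And>z. z \<in> closure {z. \<phi> z \<noteq> 0} \<Longrightarrow> cmod (\<phi> z) \<le> M"
    by (auto simp: bounded_pos)
  have M': "cmod (\<phi> z) \<le> M" for z
    using M(1) M(2)[OF subsetD[OF closure_subset], of z] by (cases "\<phi> z = 0") simp_all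
  have "integrable lebesgue (\<lambda>z. indicator \<Omega> z *\<^sub>R (cmod (f z))\<^sup>2)"
    using sq by (simp add: square_integrable_on_def set_integrable_def)
  then have int1: "integrable lborel (\<lambda>z. indicator \<Omega> z *\<^sub>R (cmod (f z))\<^sup>2)"
    using f \<Omega> by (subst (asm) integrable_completion) auto
  have int2: "integrable lborel (\<lambda>z. indicator \<Omega> z :: real)"
    using \<Omega> by simp
  show int: "integrable lborel (\<lambda>z. f z * \<phi> z)"
  proof (rule Bochner_Integration.integrable_bound)
    show "integrable lborel (\<lambda>z. M * (indicator \<Omega> z + indicator \<Omega> z *\<^sub>R (cmod (f z))\<^sup>2))"
      using int1 int2 by (intro integrable_mult_right Bochner_Integration.integrable_add)
    show "(\<lambda>z. f z * \<phi> z) \<in> borel_measurable lborel"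
      using f by simp
    have "cmod (f z) * cmod (\<phi> z) \<le> M * (1 + (cmod (f z))\<^sup>2)" for z
    proof -
      have "cmod (f z) \<le> 1 + (cmod (f z))\<^sup>2"
        using zero_le_power2[of "cmod (f z) - 1/2"] by (simp add: power2_eq_square algebra_simps)
      then have "cmod (f z) * cmod (\<phi> z) \<le> (1 + (cmod (f z))\<^sup>2) * M"
        using M' M(1) by (intro mult_mono) auto
      then show ?thesis by (simp add: mult.commute)
    qed
    moreover have "0 \<le> M * (1 + (cmod (f z))\<^sup>2)" for z
      using M(1) by (intro mult_nonneg_nonneg) auto
    ultimately show "AE z in lborel. norm (f z * \<phi> z)
        \<le> norm (M * (indicator \<Omega> z + indicator \<Omega> z *\<^sub>R (cmod (f z))\<^sup>2))"
      using out by (auto simp: norm_mult indicator_def abs_of_nonneg)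
  qed
  have "distr_of \<Omega> f \<phi> = (LINT z|lebesgue. f z * \<phi> z)"
    unfolding distr_of_def set_lebesgue_integral_def
    by (rule Bochner_Integration.integral_cong) (auto simp: indicator_def out)
  also have "\<dots> = (LINT z|lborel. f z * \<phi> z)"
    using f by (subst integral_completion) auto
  finally show "distr_of \<Omega> f \<phi> = (LINT z|lborel. f z * \<phi> z)" .
qed

lemma test_function_bounded_support:
  assumes "\<phi> \<in> test_functions \<Omega>"
  shows "\<exists>R. \<forall>t x. R < \<bar>t\<bar> \<or> R < \<bar>x\<bar> \<longrightarrow> \<phi> (t, x) = 0"
proof -
  have "bounded {z. \<phi> z \<noteq> 0}"
    using assms compact_imp_bounded bounded_subset closure_subset
    unfolding test_functions_def by blast
  then obtain R where R: "\<And>z. \<phi> z \<noteq> 0 \<Longrightarrow> norm z \<le> R"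
    by (auto simp: bounded_iff)
  have "\<bar>t\<bar> \<le> norm (t, x)" "\<bar>x\<bar> \<le> norm (t, x)" for t x :: real
    using norm_fst_le[of t x] norm_snd_le[of x t] by auto
  with R have "\<forall>t x. R < \<bar>t\<bar> \<or> R < \<bar>x\<bar> \<longrightarrow> \<phi> (t, x) = 0"
    by (metis dual_order.trans not_le)
  then show ?thesis by (rule exI)
qed

text \<open>By Fubini it suffices that on almost every line of constant t the integrand
  \<open>U * partial_x \<phi> + V * \<phi>\<close> is the derivative of the compactly supported
  product \<open>U * \<phi>\<close>. The sets \<open>X t\<close> leave room for corners of a
  profile.\<close>

lemma distr_dx_eqI:
  assumes U: "U \<in> borel_measurable borel" "square_integrable_on U \<Omega>"
    and V: "V \<in> borel_measurable borel" "square_integrable_on V \<Omega>"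
    and \<Omega>: "\<Omega> \<in> sets borel" "emeasure lborel \<Omega> < \<infinity>" and \<phi>: "\<phi> \<in> test_functions \<Omega>"
    and cont: "\<And>t. t \<noteq> 0 \<Longrightarrow> continuous_on UNIV (\<lambda>x. U (t, x))"
    and fin: "\<And>t. finite (X t)"
    and deriv: "\<And>t x. \<lbrakk>t \<noteq> 0; x \<notin> X t\<rbrakk> \<Longrightarrow> ((\<lambda>x. U (t, x)) has_vector_derivative V (t, x)) (at x)"
  shows "distr_dx (distr_of \<Omega> U) \<phi> = distr_of \<Omega> V \<phi>"
proof -
  note \<phi>x = test_functions_partial(2)[OF \<phi>]
  note diff = test_functionsD(2)[OF \<phi>] and \<phi>_cont = test_functionsD(3)[OF \<phi>]
  note intU = integrable_mult_test_function[OF U \<Omega> \<phi>x]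
  note intV = integrable_mult_test_function[OF V \<Omega> \<phi>]
  obtain R where "\<forall>t x. R < \<bar>t\<bar> \<or> R < \<bar>x\<bar> \<longrightarrow> \<phi> (t, x) = 0"
    using test_function_bounded_support[OF \<phi>] ..
  then have R: "\<phi> (t, x) = 0" if "R < \<bar>x\<bar>" for t x
    using that by simp
  define f where "f z = U z * partial_x \<phi> z + V z * \<phi> z" for z
  have "integrable lborel f"
    unfolding f_def by (rule Bochner_Integration.integrable_add[OF intU(1) intV(1)])
  then have int: "integrable (lborel \<Otimes>\<^sub>M lborel) (\<lambda>(t, x). f (t, x))"
    by (simp add: lborel_prod)
  have slice: "(LINT x|lborel. f (t, x)) = 0" if "t \<noteq> 0" for t
  proof (rule lborel_integral_derivative_eq_0[OF fin[of t]])
    show "continuous_on UNIV (\<lambda>x. U (t, x) * \<phi> (t, x))"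
      using that by (intro continuous_intros cont continuous_on_compose2[OF \<phi>_cont]) auto
    show "((\<lambda>x. U (t, x) * \<phi> (t, x)) has_vector_derivative f (t, x)) (at x)" if "x \<notin> X t" for x
      unfolding f_def using \<open>t \<noteq> 0\<close> that
      by (intro has_vector_derivative_mult deriv has_vector_derivative_partial_x diff)
    show "U (t, x) * \<phi> (t, x) = 0" if "R < \<bar>x\<bar>" for x
      using R[OF that] by simp
  qed
  have "AE t in lborel. (LINT x|lborel. f (t, x)) = 0"
    using AE_lborel_singleton[of "0 :: real"] by eventually_elim (rule slice)
  then have "(LINT t|lborel. LINT x|lborel. f (t, x)) = 0"
    by (rule integral_eq_zero_AE)
  then have "(LINT z|lborel. f z) = 0"
    using lborel_pair.integral_fst[OF int] by (simp add: lborel_prod)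
  then have "distr_of \<Omega> U (partial_x \<phi>) + distr_of \<Omega> V \<phi> = 0"
    unfolding f_def intU(2) intV(2) by (simp add: intU(1) intV(1))
  then show ?thesis
    by (simp add: distr_dx_def add_eq_0_iff2)
qed

text \<open>The same argument along lines of constant x. Continuity through the exceptional times in
  \<open>X x\<close> is what rules out a singular mass there; the intended exceptional time is t =
  0.\<close>

lemma distr_dt_eqI:
  assumes U: "U \<in> borel_measurable borel" "square_integrable_on U \<Omega>"
    and V: "V \<in> borel_measurable borel" "square_integrable_on V \<Omega>"
    and \<Omega>: "\<Omega> \<in> sets borel" "emeasure lborel \<Omega> < \<infinity>" and \<phi>: "\<phi> \<in> test_functions \<Omega>"
    and cont: "\<And>x. x \<noteq> 0 \<Longrightarrow> continuous_on UNIV (\<lambda>t. U (t, x))"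
    and fin: "\<And>x. finite (X x)"
    and deriv: "\<And>t x. \<lbrakk>x \<noteq> 0; t \<notin> X x\<rbrakk> \<Longrightarrow> ((\<lambda>t. U (t, x)) has_vector_derivative V (t, x)) (at t)"
  shows "distr_dt (distr_of \<Omega> U) \<phi> = distr_of \<Omega> V \<phi>"
proof -
  note \<phi>t = test_functions_partial(1)[OF \<phi>]
  note diff = test_functionsD(2)[OF \<phi>] and \<phi>_cont = test_functionsD(3)[OF \<phi>]
  note intU = integrable_mult_test_function[OF U \<Omega> \<phi>t]
  note intV = integrable_mult_test_function[OF V \<Omega> \<phi>]
  obtain R where "\<forall>t x. R < \<bar>t\<bar> \<or> R < \<bar>x\<bar> \<longrightarrow> \<phi> (t, x) = 0"
    using test_function_bounded_support[OF \<phi>] ..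
  then have R: "\<phi> (t, x) = 0" if "R < \<bar>t\<bar>" for t x
    using that by simp
  define f where "f z = U z * partial_t \<phi> z + V z * \<phi> z" for z
  have "integrable lborel f"
    unfolding f_def by (rule Bochner_Integration.integrable_add[OF intU(1) intV(1)])
  then have int: "integrable (lborel \<Otimes>\<^sub>M lborel) (\<lambda>(t, x). f (t, x))"
    by (simp add: lborel_prod)
  have slice: "(LINT t|lborel. f (t, x)) = 0" if "x \<noteq> 0" for x
  proof (rule lborel_integral_derivative_eq_0[OF fin[of x]])
    show "continuous_on UNIV (\<lambda>t. U (t, x) * \<phi> (t, x))"
      using that by (intro continuous_intros cont continuous_on_compose2[OF \<phi>_cont]) auto
    show "((\<lambda>t. U (t, x) * \<phi> (t, x)) has_vector_derivative f (t, x)) (at t)" if "t \<notin> X x" for t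
      unfolding f_def using \<open>x \<noteq> 0\<close> that
      by (intro has_vector_derivative_mult deriv has_vector_derivative_partial_t diff)
    show "U (t, x) * \<phi> (t, x) = 0" if "R < \<bar>t\<bar>" for t
      using R[OF that] by simp
  qed
  have "AE x in lborel. (LINT t|lborel. f (t, x)) = 0"
    using AE_lborel_singleton[of "0 :: real"] by eventually_elim (rule slice)
  then have "(LINT x|lborel. LINT t|lborel. f (t, x)) = 0"
    by (rule integral_eq_zero_AE)
  then have "(LINT z|lborel. f z) = 0"
    using lborel_pair.integral_snd[OF int] by (simp add: lborel_prod)
  then have "distr_of \<Omega> U (partial_t \<phi>) + distr_of \<Omega> V \<phi> = 0"
    unfolding f_def intU(2) intV(2) by (simp add: intU(1) intV(1))
  then show ?thesis
    by (simp add: distr_dt_def add_eq_0_iff2)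
qed

section \<open>Self-similar solutions\<close>

lemma integrable_abs_powr:
  fixes \<beta> R :: real
  assumes "-1 < \<beta>" "0 \<le> R"
  shows "integrable lborel (\<lambda>x. indicator {-R..R} x * \<bar>x\<bar> powr \<beta>)"
proof -
  have "(\<lambda>x. x powr \<beta>) integrable_on {0..R}"
    using has_integral_powr_from_0[OF assms] by blast
  then have pos: "(\<lambda>x. \<bar>x\<bar> powr \<beta>) integrable_on {0..R}"
    by (rule integrable_eq) simp
  then have "(\<lambda>x. \<bar>- x\<bar> powr \<beta>) integrable_on {-R..-0}"
    by (rule Henstock_Kurzweil_Integration.integrable_reflect_real[where f = "\<lambda>x. \<bar>x\<bar> powr \<beta>", THEN iffD2])
  then have "(\<lambda>x. \<bar>x\<bar> powr \<beta>) integrable_on {-R..R}"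
    using Henstock_Kurzweil_Integration.integrable_combine[where a = "-R" and c = 0 and b = R and f = "\<lambda>x. \<bar>x\<bar> powr \<beta>"] pos assms by simp
  then have "(\<lambda>x. \<bar>x\<bar> powr \<beta>) absolutely_integrable_on {-R..R}"
    by (rule nonnegative_absolutely_integrable_1) simp
  then have "integrable lebesgue (\<lambda>x. indicator {-R..R} x * \<bar>x\<bar> powr \<beta>)"
    by (simp add: set_integrable_def)
  then show ?thesis
    by (subst (asm) integrable_completion) auto
qed

lemma integrable_product_lborel:
  fixes f g :: "real \<Rightarrow> real"
  assumes f: "integrable lborel f" and g: "integrable lborel g"
  shows "integrable lborel (\<lambda>z. f (fst z) * g (snd z))"
proof -
  have [measurable]: "f \<in> borel_measurable borel" "g \<in> borel_measurable borel"
    using f g by (auto dest: borel_measurable_integrable)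
  have "integrable (lborel \<Otimes>\<^sub>M lborel) (\<lambda>z. f (fst z) * g (snd z))"
  proof (rule lborel_pair.Fubini_integrable)
    show "integrable lborel (\<lambda>x. LINT y|lborel. norm (f (fst (x, y)) * g (snd (x, y))))"
      using f g by (simp add: abs_mult)
    show "AE x in lborel. integrable lborel (\<lambda>y. f (fst (x, y)) * g (snd (x, y)))"
      using g by simp
  qed measurable
  then show ?thesis by (simp add: lborel_prod)
qed

lemma par_cyl_borel [measurable]: "par_cyl r t0 x0 \<in> sets borel"
  unfolding par_cyl_def by (intro borel_open open_Times) auto

lemma emeasure_par_cyl: "emeasure lborel (par_cyl r t0 x0) < \<infinity>"
  by (rule emeasure_bounded_finite) (auto simp: par_cyl_def intro!: bounded_Times)

lemma AE_lborel_coordinates_nonzero: "AE z in lborel. fst z \<noteq> (0 :: real) \<and> snd z \<noteq> (0 :: real)"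
proof -
  have "AE x in (lborel :: real measure). AE y in (lborel :: real measure). x \<noteq> 0 \<and> y \<noteq> 0"
    using AE_lborel_singleton[of "0 :: real"] 
    by eventually_elim (use AE_lborel_singleton[of "0 :: real"] in eventually_elim, simp)
  moreover have "Measurable.pred (lborel \<Otimes>\<^sub>M lborel) (\<lambda>z. fst z \<noteq> (0 :: real) \<and> snd z \<noteq> (0 :: real))"
    by measurable
  ultimately have "AE z in (lborel \<Otimes>\<^sub>M lborel). fst z \<noteq> (0 :: real) \<and> snd z \<noteq> (0 :: real)"
    by (intro lborel_pair.AE_pair_measure) (auto simp: pred_def)
  then show ?thesis unfolding lborel_prod .
qed

text \<open>A cylinder lies in a box, on which the weight is a product of two integrable powers. The
  coordinate axes, where no bound is assumed, are null.\<close>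

lemma square_integrable_on_par_cylI:
  fixes f :: "real \<times> real \<Rightarrow> complex"
  assumes f [measurable]: "f \<in> borel_measurable borel" and "-1 < \<alpha>" "-1 < \<beta>"
    and bound: "\<And>t x. \<lbrakk>t \<noteq> 0; x \<noteq> 0\<rbrakk> \<Longrightarrow> (cmod (f (t, x)))\<^sup>2 \<le> M * (\<bar>t\<bar> powr \<alpha> * \<bar>x\<bar> powr \<beta>)"
  shows "square_integrable_on f (par_cyl r t0 x0)"
proof -
  define R where "R = \<bar>t0\<bar> + r\<^sup>2"
  define S where "S = \<bar>x0\<bar> + \<bar>r\<bar>"
  \<comment> \<open>The bound at the point (1, 1) forces \<open>M\<close> to be nonnegative.\<close>
  have "0 \<le> M * (\<bar>1\<bar> powr \<alpha> * \<bar>1\<bar> powr \<beta>)"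
    by (rule order_trans[OF _ bound]) auto
  then have "0 \<le> M" by simp
  have sub: "z \<in> {-R..R} \<times> {-S..S}" if "z \<in> par_cyl r t0 x0" for z
    using that by (auto simp: par_cyl_def R_def S_def)
  have "integrable lborel (\<lambda>z. indicator (par_cyl r t0 x0) z *\<^sub>R (cmod (f z))\<^sup>2)"
  proof (rule Bochner_Integration.integrable_bound)
    show "integrable lborel (\<lambda>z. M * ((indicator {-R..R} (fst z) * \<bar>fst z\<bar> powr \<alpha>) *
        (indicator {-S..S} (snd z) * \<bar>snd z\<bar> powr \<beta>)))"
      by (intro integrable_mult_right integrable_product_lborel integrable_abs_powr assms)
        (auto simp: R_def S_def)
    show "AE z in lborel. norm (indicator (par_cyl r t0 x0) z *\<^sub>R (cmod (f z))\<^sup>2) \<le>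
        norm (M * ((indicator {-R..R} (fst z) * \<bar>fst z\<bar> powr \<alpha>) *
        (indicator {-S..S} (snd z) * \<bar>snd z\<bar> powr \<beta>)))"
      using AE_lborel_coordinates_nonzero
    proof eventually_elim
      case (elim z)
      then show ?case
        using bound[of "fst z" "snd z"] sub[of z] \<open>0 \<le> M\<close>
        by (auto simp: indicator_def abs_mult mem_Times_iff)
    qed
  qed measurable
  then have "integrable lebesgue (\<lambda>z. indicator (par_cyl r t0 x0) z *\<^sub>R (cmod (f z))\<^sup>2)"
    by (subst integrable_completion) auto
  moreover have "(\<lambda>z. indicator (par_cyl r t0 x0) z *\<^sub>R f z) \<in> borel_measurable lborel"
    by measurable
  then have "set_borel_measurable lebesgue (par_cyl r t0 x0) f"
    unfolding set_borel_measurable_def by (rule measurable_completion)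
  ultimately show ?thesis
    by (simp add: square_integrable_on_def set_integrable_def)
qed


text \<open>The index \<open>True\<close> stands for the past \<open>t < 0\<close>, the index \<open>False\<close> for the future \<open>t > 0\<close>.\<close>
locale self_similar_profile =
  fixes \<gamma> c K :: real and L :: complex and h f A :: "bool \<Rightarrow> real \<Rightarrow> complex"
    and X :: "bool \<Rightarrow> real set"
  assumes \<gamma>: "1/2 < \<gamma>" "\<gamma> < 1"
    and h_0: "h b 0 = 0"
    and h_deriv: "(h b has_vector_derivative f b y) (at y)"
    and f_cont: "continuous_on UNIV (f b)"
    and X_finite: "finite (X b)"
    and f_deriv: "y \<notin> X b \<Longrightarrow> (f b has_vector_derivative
        (if b then 1 else -1) * (y * f b y - \<gamma> * h b y) / (2 * A b y)) (at y)"
    and A_borel [measurable]: "A b \<in> borel_measurable borel"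
    and A_Re: "0 < c" "c \<le> Re (A b y)" and A_bdd: "cmod (A b y) \<le> K"
    and f_bdd: "cmod (f b y) \<le> K"
    and G_bdd: "(1 + \<bar>y\<bar>) * cmod (y * f b y - \<gamma> * h b y) \<le> K"
    and h_at_top: "((\<lambda>y. h b y / complex_of_real (\<bar>y\<bar> powr \<gamma>)) \<longlongrightarrow> L) at_top"
    and h_at_bot: "((\<lambda>y. h b y / complex_of_real (\<bar>y\<bar> powr \<gamma>)) \<longlongrightarrow> - L) at_bot"
begin

text \<open>The value at t = 0 is, for x \<noteq> 0, the limit from both sides: there x / sqrt |t|
  tends to plus or minus infinity, and both profiles grow with the same constant
  \<open>L\<close>.\<close>

definition w :: "real \<times> real \<Rightarrow> complex" where
  "w = (\<lambda>(t, x). if t = 0 then complex_of_real (sgn x * \<bar>x\<bar> powr \<gamma>) * L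
     else complex_of_real (\<bar>t\<bar> powr (\<gamma>/2)) * h (t < 0) (x / sqrt \<bar>t\<bar>))"

definition u :: "real \<times> real \<Rightarrow> complex" where
  "u = (\<lambda>(t, x). complex_of_real (\<bar>t\<bar> powr ((\<gamma>-1)/2)) * f (t < 0) (x / sqrt \<bar>t\<bar>))"

definition a :: "real \<times> real \<Rightarrow> complex" where
  "a = (\<lambda>(t, x). A (t < 0) (x / sqrt \<bar>t\<bar>))"

text \<open>Off the line t = 0 this is the time derivative of \<open>w\<close>, which the equation
  identifies with the flux a \<partial>_x u.\<close>

definition F :: "real \<times> real \<Rightarrow> complex" where
  "F = (\<lambda>(t, x). let y = x / sqrt \<bar>t\<bar> in (if t < 0 then 1 else -1) *
     complex_of_real (\<bar>t\<bar> powr (\<gamma>/2-1)) * (y * f (t < 0) y - \<gamma> * h (t < 0) y) / 2)"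

text \<open>This represents \<partial>_x u. Defining it as a quotient makes
  \<open>a z * v z = F z\<close> hold at every point, including the corners of the profile.\<close>

definition v :: "real \<times> real \<Rightarrow> complex" where
  "v z = F z / a z"

lemma F_eq:
  assumes "x / sqrt \<bar>t\<bar> = y"
  shows "F (t, x) = (if t < 0 then 1 else -1) * complex_of_real (\<bar>t\<bar> powr (\<gamma>/2-1)) *
    (y * f (t < 0) y - \<gamma> * h (t < 0) y) / 2"
  unfolding F_def prod.case assms Let_def ..

lemma a_nonzero: "a z \<noteq> 0"
proof
  assume "a z = 0"
  then have "Re (A (fst z < 0) (snd z / sqrt \<bar>fst z\<bar>)) = 0"
    by (simp add: a_def case_prod_beta)
  then show False
    using A_Re by (metis not_le)
qed

lemma h_cont: "continuous_on UNIV (h b)"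
  using h_deriv by (meson continuous_at_imp_continuous_on has_vector_derivative_continuous)

lemma measurable_profiles [measurable]:
  "h b \<in> borel_measurable borel" "f b \<in> borel_measurable borel"
  using h_cont f_cont by (auto intro: borel_measurable_continuous_onI)

lemma borel_if_negative:
  fixes g :: "bool \<Rightarrow> real \<Rightarrow> complex"
  assumes [measurable]: "\<And>b. g b \<in> borel_measurable borel"
  shows "(\<lambda>z. g (fst z < 0) (snd z / sqrt \<bar>fst z\<bar>)) \<in> borel_measurable (borel :: (real \<times> real) measure)"
proof -
  have "(\<lambda>z. if fst z < 0 then g True (snd z / sqrt \<bar>fst z\<bar>) else g False (snd z / sqrt \<bar>fst z\<bar>))
      \<in> borel_measurable (borel :: (real \<times> real) measure)"
    unfolding borel_prod[symmetric] by measurable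
  also have "(\<lambda>z. if fst z < 0 then g True (snd z / sqrt \<bar>fst z\<bar>) else g False (snd z / sqrt \<bar>fst z\<bar>))
      = (\<lambda>z. g (fst z < 0) (snd z / sqrt \<bar>fst z\<bar>))"
    by (rule ext) (metis (full_types))
  finally show ?thesis .
qed

lemma measurable_solution [measurable]:
  "w \<in> borel_measurable borel" "u \<in> borel_measurable borel" "a \<in> borel_measurable borel"
  "F \<in> borel_measurable borel" "v \<in> borel_measurable borel"
proof -
  have [measurable]: "fst \<in> borel_measurable (borel :: (real \<times> real) measure)"
    "snd \<in> borel_measurable (borel :: (real \<times> real) measure)"
    by (auto intro!: borel_measurable_continuous_onI continuous_intros)
  note [measurable] = borel_if_negative[OF measurable_profiles(1)] borel_if_negative[OF measurable_profiles(2)]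
    borel_if_negative[OF A_borel]
  show "w \<in> borel_measurable borel"
  proof -
    have "(\<lambda>z. complex_of_real (sgn (snd z) * \<bar>snd z\<bar> powr \<gamma>) * L) \<in> borel_measurable (borel :: (real \<times> real) measure)"
      by measurable
    moreover have "(\<lambda>z. complex_of_real (\<bar>fst z\<bar> powr (\<gamma>/2)) * h (fst z < 0) (snd z / sqrt \<bar>fst z\<bar>))
        \<in> borel_measurable (borel :: (real \<times> real) measure)"
      by measurable
    moreover have "{z \<in> space borel. fst z = (0 :: real)} \<in> sets (borel :: (real \<times> real) measure)"
      by (intro borel_closed) (auto intro!: closed_Collect_eq continuous_intros)
    ultimately show ?thesis
      unfolding w_def case_prod_beta by (rule measurable_If)
  qed
  show "u \<in> borel_measurable borel"
    unfolding u_def case_prod_beta by measurable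
  show a [measurable]: "a \<in> borel_measurable borel"
    unfolding a_def case_prod_beta by measurable
  show F [measurable]: "F \<in> borel_measurable borel"
    unfolding F_def case_prod_beta Let_def by measurable
  show "v \<in> borel_measurable borel"
    unfolding v_def [abs_def] by measurable
qed

lemma w_dx:
  assumes "t \<noteq> 0"
  shows "((\<lambda>x. w (t, x)) has_vector_derivative u (t, x)) (at x)"
proof -
  have "((\<lambda>x. h (t < 0) (x / sqrt \<bar>t\<bar>)) has_vector_derivative
      (1 / sqrt \<bar>t\<bar>) *\<^sub>R f (t < 0) (x / sqrt \<bar>t\<bar>)) (at x)"
    using vector_diff_chain_at[OF has_vector_derivative_divide[OF has_vector_derivative_id] h_deriv]
    by (simp add: o_def)
  then have "((\<lambda>x. complex_of_real (\<bar>t\<bar> powr (\<gamma>/2)) * h (t < 0) (x / sqrt \<bar>t\<bar>)) has_vector_derivative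
      complex_of_real (\<bar>t\<bar> powr (\<gamma>/2)) * ((1 / sqrt \<bar>t\<bar>) *\<^sub>R f (t < 0) (x / sqrt \<bar>t\<bar>))) (at x)"
    by (rule has_vector_derivative_mult_right)
  moreover have "\<bar>t\<bar> powr ((\<gamma>-1)/2) = \<bar>t\<bar> powr (\<gamma>/2) * (1 / sqrt \<bar>t\<bar>)"
    using assms by (simp add: powr_half_sqrt[symmetric] powr_diff diff_divide_distrib)
  ultimately show ?thesis
    using assms by (simp add: w_def u_def scaleR_conv_of_real mult.assoc)
qed

lemma u_cont_x: "continuous_on UNIV (\<lambda>x. u (t, x))"
  unfolding u_def prod.case
  by (cases "t = 0") (auto intro!: continuous_intros continuous_on_compose2[OF f_cont])

lemma u_dx:
  assumes "t \<noteq> 0" "x \<notin> (\<lambda>y. y * sqrt \<bar>t\<bar>) ` X (t < 0)"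
  shows "((\<lambda>x. u (t, x)) has_vector_derivative v (t, x)) (at x)"
proof -
  define y where "y = x / sqrt \<bar>t\<bar>"
  have "y \<notin> X (t < 0)"
  proof
    assume "y \<in> X (t < 0)"
    moreover have "x = y * sqrt \<bar>t\<bar>" using assms(1) by (simp add: y_def)
    ultimately show False using assms(2) by blast
  qed
  define G where "G = y * f (t < 0) y - \<gamma> * h (t < 0) y"
  define g where "g = (if t < 0 then 1 else -1) * (y * f (t < 0) y - \<gamma> * h (t < 0) y) / (2 * A (t < 0) y)"
  have "(f (t < 0) has_vector_derivative g) (at y)"
    unfolding g_def by (rule f_deriv) fact
  then have "((\<lambda>x. f (t < 0) (x / sqrt \<bar>t\<bar>)) has_vector_derivative (1 / sqrt \<bar>t\<bar>) *\<^sub>R g) (at x)"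
    using vector_diff_chain_at[OF has_vector_derivative_divide[OF has_vector_derivative_id]]
    unfolding y_def by (fastforce simp: o_def)
  then have "((\<lambda>x. complex_of_real (\<bar>t\<bar> powr ((\<gamma>-1)/2)) * f (t < 0) (x / sqrt \<bar>t\<bar>)) has_vector_derivative
      complex_of_real (\<bar>t\<bar> powr ((\<gamma>-1)/2)) * ((1 / sqrt \<bar>t\<bar>) *\<^sub>R g)) (at x)"
    by (rule has_vector_derivative_mult_right)
  moreover have "\<bar>t\<bar> powr (\<gamma>/2 - 1) = \<bar>t\<bar> powr ((\<gamma>-1)/2) * (1 / sqrt \<bar>t\<bar>)"
  proof -
    have "\<bar>t\<bar> powr ((\<gamma>-1)/2) * (1 / sqrt \<bar>t\<bar>) = \<bar>t\<bar> powr ((\<gamma>-1)/2 - 1/2)"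
      using assms by (simp add: powr_half_sqrt[symmetric] powr_diff)
    also have "(\<gamma>-1)/2 - 1/2 = \<gamma>/2 - 1" by (simp add: field_simps)
    finally show ?thesis by simp
  qed
  then have "complex_of_real (\<bar>t\<bar> powr ((\<gamma>-1)/2)) * ((1 / sqrt \<bar>t\<bar>) *\<^sub>R g) = v (t, x)"
    unfolding v_def F_eq[OF y_def[symmetric]] a_def prod.case y_def[symmetric] g_def
      G_def[symmetric]
    by (simp add: scaleR_conv_of_real)
  ultimately show ?thesis
    by (simp only: u_def prod.case)
qed

lemma w_dt:
  assumes "t \<noteq> 0"
  shows "((\<lambda>t. w (t, x)) has_vector_derivative F (t, x)) (at t)"
proof -
  \<comment> \<open>With the sign frozen, s r agrees with |r| for r near t and is smooth, so one
    computation serves both half-planes.\<close>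
  define s where "s = (if t < 0 then - 1 else 1 :: real)"
  define y where "y = x / sqrt \<bar>t\<bar>"
  have st: "s * t = \<bar>t\<bar>" "s * t > 0" using assms by (auto simp: s_def)
  have "((\<lambda>t. complex_of_real ((s * t) powr (\<gamma>/2)) * h (s = - 1) (x / sqrt (s * t))) has_vector_derivative
     F (t, x)) (at t)"
  proof -
    have d1: "((\<lambda>t. x / sqrt (s * t)) has_vector_derivative - s * y / (2 * (s * t))) (at t)"
      unfolding has_real_derivative_iff_has_vector_derivative[symmetric]
      using st by (auto intro!: derivative_eq_intros simp: y_def field_simps power2_eq_square)
    have d2: "((\<lambda>t. h (s = - 1) (x / sqrt (s * t))) has_vector_derivative
        (- s * y / (2 * (s * t))) *\<^sub>R f (s = - 1) y) (at t)"
      using vector_diff_chain_at[OF d1, of "h (s = - 1)"] h_deriv by (simp add: o_def st y_def)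
    have "((\<lambda>t. (s * t) powr (\<gamma>/2)) has_real_derivative s * (\<gamma>/2) * (s * t) powr (\<gamma>/2 - 1)) (at t)"
      using st by (auto intro!: derivative_eq_intros)
    then have d3: "((\<lambda>t. complex_of_real ((s * t) powr (\<gamma>/2))) has_vector_derivative
        complex_of_real (s * (\<gamma>/2) * (s * t) powr (\<gamma>/2 - 1))) (at t)"
      unfolding has_real_derivative_iff_has_vector_derivative
      by (rule bounded_linear.has_vector_derivative[OF bounded_linear_of_real])
    have powr: "(s * t) powr (\<gamma>/2) = (s * t) powr (\<gamma>/2 - 1) * (s * t)"
      using st by (simp add: powr_diff)
    have s_eq: "s = - 1 \<longleftrightarrow> t < 0" by (simp add: s_def)
    define P where "P = (s * t) powr (\<gamma>/2 - 1)"
    have "complex_of_real ((s * t) powr (\<gamma>/2)) * ((- s * y / (2 * (s * t))) *\<^sub>R f (s = - 1) y) =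
        complex_of_real ((s * t) powr (\<gamma>/2) * (- s * y / (2 * (s * t)))) * f (s = - 1) y"
      by (simp only: scaleR_conv_of_real of_real_mult mult.assoc)
    also have "(s * t) powr (\<gamma>/2) * (- s * y / (2 * (s * t))) = - s * P * y / 2"
      unfolding powr P_def[symmetric] using assms by (simp add: s_def)
    finally have "complex_of_real ((s * t) powr (\<gamma>/2)) * ((- s * y / (2 * (s * t))) *\<^sub>R f (s = - 1) y) +
        complex_of_real (s * (\<gamma>/2) * (s * t) powr (\<gamma>/2 - 1)) * h (s = - 1) (x / sqrt (s * t)) = F (t, x)"
      unfolding F_eq[OF y_def[symmetric]] st(1) P_def[symmetric] y_def[symmetric] P_def[unfolded st(1), symmetric] s_eq
      by (cases "t < 0") (simp_all add: s_def algebra_simps)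
    then show ?thesis
      by (rule has_vector_derivative_eq_rhs[OF has_vector_derivative_mult[OF d3 d2]])
  qed
  then show ?thesis
  proof (rule has_vector_derivative_transform_within_open)
    show "open {r. s * r > 0}" by (intro open_Collect_less continuous_intros)
    show "t \<in> {r. s * r > 0}" using st by simp
    show "complex_of_real ((s * r) powr (\<gamma>/2)) * h (s = - 1) (x / sqrt (s * r)) = w (r, x)"
      if "r \<in> {r. s * r > 0}" for r
      using that by (auto simp: w_def s_def split: if_splits)
  qed
qed

text \<open>For \<open>x \<noteq> 0\<close> the value \<open>w (t, x)\<close> is \<open>\<bar>x\<bar> powr \<gamma>\<close> times \<open>h y / \<bar>y\<bar> powr \<gamma>\<close> at \<open>y = x / sqrt \<bar>t\<bar>\<close>.\<close>
lemma w_cont_t: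
  assumes "x \<noteq> 0"
  shows "continuous_on UNIV (\<lambda>t. w (t, x))"
proof (rule continuous_at_imp_continuous_on, rule ballI)
  fix t :: real
  show "isCont (\<lambda>t. w (t, x)) t"
  proof (cases "t = 0")
    case False
    then show ?thesis using w_dt has_vector_derivative_continuous by blast
  next
    case True
    define q where "q b y = h b y / complex_of_real (\<bar>y\<bar> powr \<gamma>)" for b y
    have "filterlim (\<lambda>t. sqrt \<bar>t\<bar>) (at_right 0) (at (0 :: real))"
      unfolding filterlim_at by (auto intro!: tendsto_eq_intros simp: eventually_at_filter)
    then have inv: "filterlim (\<lambda>t. inverse (sqrt \<bar>t\<bar>)) at_top (at (0 :: real))"
      by (rule filterlim_compose[OF filterlim_inverse_at_top_right])
    have "((\<lambda>t. q b (x / sqrt \<bar>t\<bar>)) \<longlongrightarrow> complex_of_real (sgn x) * L) (at 0)" for b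
    proof (cases "x > 0")
      case True
      have "filterlim (\<lambda>t. x * inverse (sqrt \<bar>t\<bar>)) at_top (at 0)"
        by (rule filterlim_tendsto_pos_mult_at_top[OF tendsto_const True inv])
      then show ?thesis
        using filterlim_compose[OF h_at_top, of "\<lambda>t. x * inverse (sqrt \<bar>t\<bar>)" "at 0" b] True
        by (simp add: q_def divide_inverse)
    next
      case False
      with assms have "x < 0" by simp
      have "filterlim (\<lambda>t. x * inverse (sqrt \<bar>t\<bar>)) at_bot (at 0)"
        by (rule filterlim_tendsto_neg_mult_at_bot[OF tendsto_const \<open>x < 0\<close> inv])
      then show ?thesis
        using filterlim_compose[OF h_at_bot, of "\<lambda>t. x * inverse (sqrt \<bar>t\<bar>)" "at 0" b] \<open>x < 0\<close>
        by (simp add: q_def divide_inverse)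
    qed
    from this[of True] this[of False]
    have "((\<lambda>t. if t < 0 then q True (x / sqrt \<bar>t\<bar>) else q False (x / sqrt \<bar>t\<bar>)) \<longlongrightarrow>
        complex_of_real (sgn x) * L) (at 0)"
      by (intro filterlim_If) (auto intro: tendsto_mono[OF inf_le1])
    then have lim: "((\<lambda>t. complex_of_real (\<bar>x\<bar> powr \<gamma>) * (if t < 0 then q True (x / sqrt \<bar>t\<bar>) else q False (x / sqrt \<bar>t\<bar>)))
       \<longlongrightarrow> complex_of_real (\<bar>x\<bar> powr \<gamma>) * (complex_of_real (sgn x) * L)) (at 0)"
      by (intro tendsto_intros)
    have ev: "\<forall>\<^sub>F t in at 0. complex_of_real (\<bar>x\<bar> powr \<gamma>) *
        (if t < 0 then q True (x / sqrt \<bar>t\<bar>) else q False (x / sqrt \<bar>t\<bar>)) = w (t, x)"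
    proof -
      have "complex_of_real (\<bar>x\<bar> powr \<gamma>) *
        (if t < 0 then q True (x / sqrt \<bar>t\<bar>) else q False (x / sqrt \<bar>t\<bar>)) = w (t, x)" if "t \<noteq> 0" for t
      proof -
        have "\<bar>x / sqrt \<bar>t\<bar>\<bar> powr \<gamma> = \<bar>x\<bar> powr \<gamma> / \<bar>t\<bar> powr (\<gamma>/2)"
          using that by (simp add: abs_divide powr_divide powr_half_sqrt[symmetric] powr_powr)
        moreover have "\<bar>x\<bar> powr \<gamma> \<noteq> 0" "\<bar>t\<bar> powr (\<gamma>/2) \<noteq> 0"
          using assms that by auto
        ultimately have q: "complex_of_real (\<bar>x\<bar> powr \<gamma>) * q b (x / sqrt \<bar>t\<bar>) =
            complex_of_real (\<bar>t\<bar> powr (\<gamma>/2)) * h b (x / sqrt \<bar>t\<bar>)" for b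
          unfolding q_def by simp
        have if_q: "(if P then q True Y else q False Y) = q P Y" for P Y
          by (cases P) simp_all
        have w_eq: "w (t, x) = complex_of_real (\<bar>t\<bar> powr (\<gamma>/2)) * h (t < 0) (x / sqrt \<bar>t\<bar>)"
          unfolding w_def prod.case using that by (rule if_not_P)
        show ?thesis
          unfolding if_q w_eq by (rule q)
      qed
      then show ?thesis by (simp add: eventually_at_filter)
    qed
    have "complex_of_real (\<bar>x\<bar> powr \<gamma>) * (complex_of_real (sgn x) * L) = w (0, x)"
      by (simp add: w_def)
    then show ?thesis
      using Lim_transform_eventually[OF lim ev] unfolding True isCont_def by simp
  qed
qed

lemma h_bound: "cmod (h b y) \<le> K * \<bar>y\<bar>"
proof -
  have "norm (h b y - h b 0) \<le> K * norm (y - 0)"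
  proof (rule differentiable_bound[where S = UNIV])
    show "(h b has_derivative (\<lambda>r. r *\<^sub>R f b y)) (at y within UNIV)" for y
      using h_deriv[of b y] by (simp add: has_vector_derivative_def)
    show "onorm (\<lambda>r. r *\<^sub>R f b y) \<le> K" for y
      using mult_left_mono[OF f_bdd abs_ge_zero] by (intro onorm_le) (simp add: mult.commute)
  qed auto
  then show ?thesis by (simp add: h_0)
qed

text \<open>The decay (1 + |y|)^(-2) of the squared profile is weakened to |y| to the power \<gamma>
  - 3/2, which separates the variables. This exponent is chosen so that the resulting powers of |t|
  and |x| are both -1 at \<gamma> = 1/2 and both exceed -1 as soon as \<gamma> > 1/2.\<close>

lemma F_bound:
  assumes "t \<noteq> 0" "x \<noteq> 0"
  shows "(cmod (F (t, x)))\<^sup>2 \<le> K\<^sup>2 * (\<bar>t\<bar> powr (\<gamma>/2 - 5/4) * \<bar>x\<bar> powr (\<gamma> - 3/2))"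
proof -
  define y where "y = x / sqrt \<bar>t\<bar>"
  define g where "g = y * f (t < 0) y - \<gamma> * h (t < 0) y"
  have y: "\<bar>y\<bar> > 0" using assms by (simp add: y_def)
  have "(1 + \<bar>y\<bar>) * cmod g \<le> K" using G_bdd by (simp add: g_def)
  then have "cmod g \<le> K * inverse (1 + \<bar>y\<bar>)" by (simp add: field_simps)
  then have g2: "(cmod g)\<^sup>2 \<le> (K * inverse (1 + \<bar>y\<bar>))\<^sup>2" by (intro power_mono) auto
  have "\<bar>y\<bar> powr (3/2 - \<gamma>) \<le> (1 + \<bar>y\<bar>) powr (3/2 - \<gamma>)"
    using \<gamma> by (intro powr_mono2) auto
  also have "\<dots> \<le> (1 + \<bar>y\<bar>) powr 2" using \<gamma> by (intro powr_mono) auto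
  finally have "\<bar>y\<bar> powr (3/2 - \<gamma>) \<le> (1 + \<bar>y\<bar>)\<^sup>2" by (simp add: powr_numeral)
  then have "inverse ((1 + \<bar>y\<bar>)\<^sup>2) \<le> inverse (\<bar>y\<bar> powr (3/2 - \<gamma>))"
    using y by (intro le_imp_inverse_le) auto
  also have "\<dots> = \<bar>y\<bar> powr (\<gamma> - 3/2)" by (simp add: powr_minus[symmetric])
  finally have "(K * inverse (1 + \<bar>y\<bar>))\<^sup>2 \<le> K\<^sup>2 * \<bar>y\<bar> powr (\<gamma> - 3/2)"
    by (simp add: power_mult_distrib power_inverse mult_left_mono)
  with g2 have g3: "(cmod g)\<^sup>2 \<le> K\<^sup>2 * \<bar>y\<bar> powr (\<gamma> - 3/2)" by simp
  have "\<bar>y\<bar> powr (\<gamma> - 3/2) = \<bar>x\<bar> powr (\<gamma> - 3/2) / \<bar>t\<bar> powr ((\<gamma> - 3/2) / 2)"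
    using assms by (simp add: y_def abs_divide powr_divide powr_half_sqrt[symmetric] powr_powr)
  moreover have "(\<bar>t\<bar> powr (\<gamma>/2-1))\<^sup>2 = \<bar>t\<bar> powr (\<gamma>/2 - 5/4) * \<bar>t\<bar> powr ((\<gamma> - 3/2) / 2)"
    unfolding power2_eq_square powr_add[symmetric] by (rule arg_cong) (simp add: field_simps)
  moreover have "\<bar>t\<bar> powr ((\<gamma> - 3/2) / 2) \<noteq> 0" using assms by simp
  ultimately have eq: "(\<bar>t\<bar> powr (\<gamma>/2-1))\<^sup>2 * \<bar>y\<bar> powr (\<gamma> - 3/2) =
      \<bar>t\<bar> powr (\<gamma>/2 - 5/4) * \<bar>x\<bar> powr (\<gamma> - 3/2)"
    by simp
  have "cmod (F (t, x)) = \<bar>t\<bar> powr (\<gamma>/2-1) * cmod g / 2"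
    unfolding F_eq[OF y_def[symmetric]] g_def by (simp add: norm_mult norm_divide)
  also have "\<dots> \<le> \<bar>t\<bar> powr (\<gamma>/2-1) * cmod g" by simp
  finally have "(cmod (F (t, x)))\<^sup>2 \<le> (\<bar>t\<bar> powr (\<gamma>/2-1) * cmod g)\<^sup>2" by (intro power_mono) auto
  also have "\<dots> \<le> (\<bar>t\<bar> powr (\<gamma>/2-1))\<^sup>2 * (K\<^sup>2 * \<bar>y\<bar> powr (\<gamma> - 3/2))"
    unfolding power_mult_distrib using g3 by (intro mult_left_mono) auto
  also have "\<dots> = K\<^sup>2 * ((\<bar>t\<bar> powr (\<gamma>/2-1))\<^sup>2 * \<bar>y\<bar> powr (\<gamma> - 3/2))" by simp
  finally show ?thesis unfolding eq .
qed

lemma square_integrable_solution: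
  "square_integrable_on w (par_cyl r t0 x0)" "square_integrable_on u (par_cyl r t0 x0)"
  "square_integrable_on F (par_cyl r t0 x0)" "square_integrable_on v (par_cyl r t0 x0)"
proof -
  have powr: "(\<bar>t\<bar> powr ((\<gamma>-1)/2))\<^sup>2 = \<bar>t\<bar> powr (\<gamma> - 1)" for t
    by (simp add: powr_add[symmetric] power2_eq_square)
  show "square_integrable_on w (par_cyl r t0 x0)"
  proof (rule square_integrable_on_par_cylI[where \<alpha> = "\<gamma> - 1" and \<beta> = 2 and M = "K\<^sup>2"])
    fix t x :: real assume "t \<noteq> 0" "x \<noteq> 0"
    have "\<bar>t\<bar> powr ((\<gamma>-1)/2) = \<bar>t\<bar> powr (\<gamma>/2) / sqrt \<bar>t\<bar>"
      using \<open>t \<noteq> 0\<close> by (simp add: powr_half_sqrt[symmetric] powr_diff diff_divide_distrib)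
    moreover have "cmod (w (t, x)) \<le> \<bar>t\<bar> powr (\<gamma>/2) * (K * \<bar>x / sqrt \<bar>t\<bar>\<bar>)"
      using \<open>t \<noteq> 0\<close> mult_left_mono[OF h_bound[of "t < 0" "x / sqrt \<bar>t\<bar>"], of "\<bar>t\<bar> powr (\<gamma>/2)"]
      by (simp only: w_def prod.case if_False norm_mult norm_of_real abs_of_nonneg powr_ge_zero)
    ultimately have "cmod (w (t, x)) \<le> K * (\<bar>t\<bar> powr ((\<gamma>-1)/2) * \<bar>x\<bar>)"
      by (simp add: abs_divide mult.left_commute)
    then have "(cmod (w (t, x)))\<^sup>2 \<le> (K * (\<bar>t\<bar> powr ((\<gamma>-1)/2) * \<bar>x\<bar>))\<^sup>2"
      by (intro power_mono) auto
    then show "(cmod (w (t, x)))\<^sup>2 \<le> K\<^sup>2 * (\<bar>t\<bar> powr (\<gamma>-1) * \<bar>x\<bar> powr 2)"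
      using \<open>x \<noteq> 0\<close> by (simp only: power_mult_distrib powr) (simp add: powr_numeral)
  qed (use \<gamma> in auto)
  show "square_integrable_on u (par_cyl r t0 x0)"
  proof (rule square_integrable_on_par_cylI[where \<alpha> = "\<gamma> - 1" and \<beta> = 0 and M = "K\<^sup>2"])
    fix t x :: real assume "t \<noteq> 0" "x \<noteq> 0"
    have "(cmod (u (t, x)))\<^sup>2 \<le> (\<bar>t\<bar> powr ((\<gamma>-1)/2) * K)\<^sup>2"
      by (intro power_mono) (auto simp: u_def norm_mult intro!: mult_left_mono f_bdd)
    then show "(cmod (u (t, x)))\<^sup>2 \<le> K\<^sup>2 * (\<bar>t\<bar> powr (\<gamma>-1) * \<bar>x\<bar> powr 0)"
      using \<open>x \<noteq> 0\<close> by (simp only: power_mult_distrib powr) (simp add: mult.commute)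
  qed (use \<gamma> in auto)
  show "square_integrable_on F (par_cyl r t0 x0)"
    using \<gamma> by (intro square_integrable_on_par_cylI[OF _ _ _ F_bound]) auto
  show "square_integrable_on v (par_cyl r t0 x0)"
  proof (rule square_integrable_on_par_cylI[where \<alpha> = "\<gamma>/2 - 5/4" and \<beta> = "\<gamma> - 3/2" and M = "K\<^sup>2 / c\<^sup>2"])
    fix t x :: real assume "t \<noteq> 0" "x \<noteq> 0"
    have "c \<le> cmod (a (t, x))"
      using order_trans[OF A_Re(2) complex_Re_le_cmod] by (simp add: a_def)
    then have "(cmod (v (t, x)))\<^sup>2 \<le> (cmod (F (t, x)))\<^sup>2 / c\<^sup>2"
      using A_Re(1) unfolding v_def norm_divide power_divide
      by (intro divide_left_mono power_mono mult_pos_pos) (auto intro!: zero_less_power order.strict_trans2[of 0 c])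
    also have "\<dots> \<le> K\<^sup>2 * (\<bar>t\<bar> powr (\<gamma>/2 - 5/4) * \<bar>x\<bar> powr (\<gamma> - 3/2)) / c\<^sup>2"
      using \<open>t \<noteq> 0\<close> \<open>x \<noteq> 0\<close> by (intro divide_right_mono F_bound) auto
    finally show "(cmod (v (t, x)))\<^sup>2 \<le> K\<^sup>2 / c\<^sup>2 * (\<bar>t\<bar> powr (\<gamma>/2 - 5/4) * \<bar>x\<bar> powr (\<gamma> - 3/2))"
      by simp
  qed (use \<gamma> in auto)
qed

text \<open>Both terms of the equation equal the pairing of \<open>w\<close> with \<open>\<partial>\<^sub>t\<partial>\<^sub>x\<phi>\<close>, since \<open>u = \<partial>\<^sub>xw\<close> and
  \<open>a \<partial>\<^sub>xu = \<partial>\<^sub>tw\<close>.\<close>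
lemma solution: "solution_in_plane a u"
  unfolding solution_in_plane_def
proof (intro allI impI)
  fix r t0 x0 :: real
  define Q where "Q = par_cyl r t0 x0"
  have Q: "Q \<in> sets borel" "emeasure lborel Q < \<infinity>"
    unfolding Q_def by (rule par_cyl_borel emeasure_par_cyl)+
  note sq = square_integrable_solution[of r t0 x0, folded Q_def]
  have u_v: "distr_dx (distr_of Q u) \<phi> = distr_of Q v \<phi>" if "\<phi> \<in> test_functions Q" for \<phi>
    by (rule distr_dx_eqI[OF _ sq(2) _ sq(4) Q that u_cont_x _ u_dx]) (auto intro: X_finite)
  have w_u: "distr_dx (distr_of Q w) \<phi> = distr_of Q u \<phi>" if "\<phi> \<in> test_functions Q" for \<phi>
    by (rule distr_dx_eqI[OF _ sq(1) _ sq(2) Q that _ finite.emptyI w_dx])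
      (auto intro!: continuous_at_imp_continuous_on has_vector_derivative_continuous[OF w_dx])
  \<comment> \<open>The only exceptional time is 0, and the matching of the two profiles enters here
    through \<open>w_cont_t\<close>.\<close>
  have w_F: "distr_dt (distr_of Q w) \<phi> = distr_of Q F \<phi>" if "\<phi> \<in> test_functions Q" for \<phi>
    by (rule distr_dt_eqI[OF _ sq(1) _ sq(3) Q that w_cont_t _ w_dt, where X = "\<lambda>_. {0}"]) auto
  have av: "(\<lambda>z. a z * v z) = F"
    using a_nonzero by (auto simp: v_def)
  have "distr_dt (distr_of Q u) \<phi> - distr_dx (distr_of Q F) \<phi> = 0" if "\<phi> \<in> test_functions Q" for \<phi>
    using w_u[OF test_functions_partial(1)[OF that]] w_F[OF test_functions_partial(2)[OF that]]
      mixed_partials_commute[OF test_functionsD(1)[OF that]]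
    by (simp add: distr_dt_def distr_dx_def)
  then show "solution_in_cyl a u r t0 x0"
    unfolding solution_in_cyl_def Q_def[symmetric] Let_def distr_eq_on_def
    using sq u_v by (intro conjI exI[of _ v]) (auto simp: av)
qed

lemma coefficient:
  "bounded (range a)" "a \<in> borel_measurable lebesgue" "strictly_accretive a"
proof -
  show "bounded (range a)"
    unfolding bounded_iff using A_bdd by (auto simp: a_def)
  show "a \<in> borel_measurable lebesgue"
    by (rule measurable_completion) simp
  show "strictly_accretive a"
    unfolding strictly_accretive_def using A_Re by (auto simp: a_def split: prod.split)
qed

end

section \<open>Divergence of the integral at the origin\<close>

lemma nn_integral_inverse_eq_infinity:
  assumes "0 < (r :: real)"
  shows "(\<integral>\<^sup>+t. ennreal (2 / (- t)) * indicator {- r<..<0} t \<partial>lborel) = \<infinity>"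
proof (rule ccontr)
  assume "\<not> ?thesis"
  then obtain s where s: "(\<integral>\<^sup>+t. ennreal (2 / (- t)) * indicator {- r<..<0} t \<partial>lborel) = ennreal s" "0 \<le> s"
    by (metis ennreal_cases infinity_ennreal_def)
  \<comment> \<open>The integral from \<open>A\<close> to \<open>B\<close> is 2 ln(A/B) = 2(s + 1),
    which exceeds the supposed total \<open>s\<close>.\<close>
  define A B where "A = - (r / 2)" and "B = A * exp (- (s + 1))"
  have AB: "A < 0" "B < 0" "A \<le> B" "- r < A"
    using assms s(2) by (auto simp: A_def B_def)
  have "(\<integral>\<^sup>+t. ennreal (2 / (- t)) * indicator {A..B} t \<partial>lborel) = ennreal ((- 2 * ln (- B)) - (- 2 * ln (- A)))"
  proof (rule nn_integral_FTC_Icc)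
    fix t assume "t \<in> {A..B}"
    then have "t < 0" using AB by simp
    then show "((\<lambda>t. - 2 * ln (- t)) has_real_derivative 2 / (- t)) (at t)"
      by (auto intro!: derivative_eq_intros)
    show "0 \<le> 2 / (- t)" using \<open>t < 0\<close> by simp
  qed (use AB in auto)
  also have "(- 2 * ln (- B)) - (- 2 * ln (- A)) = 2 * (s + 1)"
  proof -
    have "ln (- B) = ln ((- A) * exp (- (s + 1)))" by (simp add: B_def)
    also have "\<dots> = ln (- A) + ln (exp (- (s + 1)))" using AB by (intro ln_mult_pos) auto
    finally show ?thesis by simp
  qed
  finally have eq: "(\<integral>\<^sup>+t. ennreal (2 / (- t)) * indicator {A..B} t \<partial>lborel) = ennreal (2 * (s + 1))" .
  have "(\<integral>\<^sup>+t. ennreal (2 / (- t)) * indicator {A..B} t \<partial>lborel) \<le>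
      (\<integral>\<^sup>+t. ennreal (2 / (- t)) * indicator {- r<..<0} t \<partial>lborel)"
    using AB by (intro nn_integral_mono mult_left_mono) (auto simp: indicator_def)
  then have "ennreal (2 * (s + 1)) \<le> ennreal s"
    unfolding eq s(1) .
  then have "2 * (s + 1) \<le> s" by (rule ennreal_le_iff[OF s(2), THEN iffD1])
  then show False using s(2) by simp
qed

text \<open>The slice at time t has width 2 sqrt(-t), which turns the integrand into 2/(-t): the
  logarithmically divergent borderline case.\<close>

lemma nn_integral_parabola_eq_infinity:
  assumes "0 < (r :: real)"
  shows "(\<integral>\<^sup>+z. ennreal ((- fst z) powr (- 3/2)) *
    indicator {z. - r < fst z \<and> fst z < 0 \<and> \<bar>snd z\<bar> \<le> sqrt (- fst z)} z \<partial>lborel) = \<infinity>"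
proof -
  define P where "P = {z :: real \<times> real. - r < fst z \<and> fst z < 0 \<and> \<bar>snd z\<bar> \<le> sqrt (- fst z)}"
  define g where "g = (\<lambda>z. ennreal ((- fst z) powr (- 3/2)) * indicator P z)"
  have "P \<in> sets (lborel \<Otimes>\<^sub>M lborel)"
  proof -
    have "P = {z. - r < fst z} \<inter> {z. fst z < 0} \<inter> {z. \<bar>snd z\<bar> \<le> sqrt (- fst z)}"
      by (auto simp: P_def)
    also have "\<dots> \<in> sets borel"
      by (intro sets.Int borel_open borel_closed open_Collect_less closed_Collect_le continuous_intros)
    finally show ?thesis
      unfolding lborel_prod by simp
  qed
  have g: "g \<in> borel_measurable (lborel \<Otimes>\<^sub>M lborel)"
    unfolding g_def
  proof (intro borel_measurable_times_ennreal borel_measurable_indicator)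
    show "(\<lambda>z. ennreal ((- fst z) powr (- 3/2))) \<in> borel_measurable (lborel \<Otimes>\<^sub>M (lborel :: real measure))"
      by (rule measurable_compose[OF measurable_fst, of "\<lambda>t. ennreal ((- t) powr (- 3/2))"]) simp
  qed fact
  have inner: "(\<integral>\<^sup>+x. g (t, x) \<partial>lborel) = ennreal (2 / (- t)) * indicator {- r<..<0} t" for t
  proof (cases "t \<in> {- r<..<0}")
    case True
    have "(- t) powr (- 3/2) * sqrt (- t) = (- t) powr (- 3/2 + 1/2)"
      using True powr_half_sqrt[of "- t"] unfolding powr_add by simp
    also have "- 3/2 + 1/2 = (- 1 :: real)" by simp
    also have "(- t) powr - 1 = 1 / (- t)"
      using True by (simp add: powr_minus_divide)
    finally have eq: "(- t) powr (- 3/2) * (2 * sqrt (- t)) = 2 / (- t)" by simp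
    have "indicator P (t, x) = (indicator {- sqrt (- t)..sqrt (- t)} x :: ennreal)" for x
      using True by (auto simp: P_def indicator_def)
    then have "(\<integral>\<^sup>+x. g (t, x) \<partial>lborel) =
        (\<integral>\<^sup>+x. ennreal ((- t) powr (- 3/2)) * indicator {- sqrt (- t)..sqrt (- t)} x \<partial>lborel)"
      by (simp add: g_def)
    also have "\<dots> = ennreal ((- t) powr (- 3/2)) * ennreal (2 * sqrt (- t))"
      using True by (subst nn_integral_cmult_indicator) auto
    also have "\<dots> = ennreal (2 / (- t))"
      unfolding eq[symmetric] using True by (intro ennreal_mult[symmetric]) auto
    finally show ?thesis using True by simp
  next
    case False
    then have "g (t, x) = 0" for x by (auto simp: g_def P_def)
    then show ?thesis using False by simp
  qed
  have "(\<integral>\<^sup>+z. g z \<partial>(lborel \<Otimes>\<^sub>M lborel)) = (\<integral>\<^sup>+t. \<integral>\<^sup>+x. g (t, x) \<partial>lborel \<partial>lborel)"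
    by (rule lborel.nn_integral_fst[OF g, symmetric])
  also have "\<dots> = \<infinity>"
    unfolding inner by (rule nn_integral_inverse_eq_infinity[OF assms])
  finally show ?thesis
    unfolding g_def P_def lborel_prod .
qed

context self_similar_profile begin

text \<open>On the region |x| \<le> sqrt(-t) the profile is evaluated at |y| \<le> 1, so |u| is at
  least (-t) to the power (\<gamma> - 1)/2. The relation between \<open>p\<close> and
  \<open>\<gamma>\<close> makes its p-th power at least (-t)^(-3/2).\<close>

lemma blowup:
  assumes p: "p * (1 - \<gamma>) = 3" "0 < p" and f_ge: "\<And>y. \<bar>y\<bar> \<le> 1 \<Longrightarrow> 1 \<le> cmod (f True y)" and "0 < \<epsilon>"
  shows "(\<integral>\<^sup>+z\<in>par_cyl \<epsilon> 0 0. ennreal (cmod (u z) powr p) \<partial>lebesgue) = \<infinity>"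
proof -
  define P where "P = {z :: real \<times> real. - (\<epsilon>\<^sup>2) < fst z \<and> fst z < 0 \<and> \<bar>snd z\<bar> \<le> sqrt (- fst z)}"
  have exponent: "(\<gamma> - 1) / 2 * p = - 3/2" using p(1) by (simp add: field_simps)
  have le: "ennreal ((- fst z) powr (- 3/2)) * indicator P z
      \<le> ennreal (cmod (u z) powr p) * indicator (par_cyl \<epsilon> 0 0) z" for z
  proof (cases "z \<in> P")
    case False
    then show ?thesis by simp
  next
    case True
    obtain t x where z: "z = (t, x)" by force
    have t: "- (\<epsilon>\<^sup>2) < t" "t < 0" "\<bar>x\<bar> \<le> sqrt (- t)" using True by (auto simp: P_def z)
    have "sqrt (- t) < \<epsilon>" using t \<open>0 < \<epsilon>\<close> by (intro real_less_lsqrt) auto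
    with t have in_cyl: "z \<in> par_cyl \<epsilon> 0 0" by (auto simp: z par_cyl_def)
    have "1 \<le> cmod (f True (x / sqrt (- t)))" using t by (intro f_ge) (simp add: abs_divide)
    then have "(- t) powr ((\<gamma>-1)/2) * 1 \<le> (- t) powr ((\<gamma>-1)/2) * cmod (f True (x / sqrt (- t)))"
      by (rule mult_left_mono) simp
    also have "\<dots> = cmod (u z)"
      using t by (simp add: u_def z norm_mult)
    finally have "((- t) powr ((\<gamma>-1)/2) * 1) powr p \<le> cmod (u z) powr p"
      using p by (intro powr_mono2) auto
    then have "(- t) powr (- 3/2) \<le> cmod (u z) powr p"
      by (simp only: powr_powr exponent mult_1_right)
    then show ?thesis
      using True in_cyl by (simp add: z ennreal_leI)
  qed
  have "\<infinity> = (\<integral>\<^sup>+z. ennreal ((- fst z) powr (- 3/2)) * indicator P z \<partial>lborel)"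
    unfolding P_def by (rule nn_integral_parabola_eq_infinity[symmetric]) (use \<open>0 < \<epsilon>\<close> in simp)
  also have "\<dots> \<le> (\<integral>\<^sup>+z\<in>par_cyl \<epsilon> 0 0. ennreal (cmod (u z) powr p) \<partial>lborel)"
    by (intro nn_integral_mono le)
  finally have "(\<integral>\<^sup>+z\<in>par_cyl \<epsilon> 0 0. ennreal (cmod (u z) powr p) \<partial>lborel) = \<infinity>"
    by (simp add: top_unique)
  then show ?thesis
    by (simp only: nn_integral_completion)
qed

end

text \<open>Profiles \<open>h y = y * exp (D (y\<^sup>2))\<close>, where \<open>d\<close> and \<open>e\<close> are the first two derivatives of \<open>D\<close>.\<close>
locale exponential_profile =
  fixes \<gamma> c K :: real and L :: complex and D d e A :: "bool \<Rightarrow> real \<Rightarrow> complex"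
    and X :: "bool \<Rightarrow> real set"
  assumes \<gamma>: "1/2 < \<gamma>" "\<gamma> < 1"
    and D_deriv: "0 \<le> q \<Longrightarrow> (D b has_vector_derivative d b q) (at q)"
    and d_cont: "0 \<le> q \<Longrightarrow> isCont (d b) q"
    and X_finite: "finite (X b)"
    and d_deriv: "\<lbrakk>0 \<le> q; q \<notin> X b\<rbrakk> \<Longrightarrow> (d b has_vector_derivative e b q) (at q)"
    and coefficient_eq: "\<lbrakk>0 \<le> q; q \<notin> X b\<rbrakk> \<Longrightarrow>
        (if b then 1 else -1) * 2 * A b q * (6 * d b q + 4 * complex_of_real q * (d b q)\<^sup>2 + 4 * complex_of_real q * e b q)
        = 1 - complex_of_real \<gamma> + 2 * complex_of_real q * d b q"
    and A_borel: "A b \<in> borel_measurable borel"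
    and A_Re: "0 < c" "0 \<le> q \<Longrightarrow> c \<le> Re (A b q)"
    and A_bdd: "0 \<le> q \<Longrightarrow> cmod (A b q) \<le> K"
    and D_lim: "((\<lambda>q. D b q + (1 - \<gamma>) / 2 * ln q) \<longlongrightarrow> L) at_top"
    and d_bdd: "0 \<le> q \<Longrightarrow> (1 + q) * cmod (1 - complex_of_real \<gamma> + 2 * complex_of_real q * d b q) \<le> K"
begin

definition h :: "bool \<Rightarrow> real \<Rightarrow> complex" where
  "h b y = y * exp (D b (y\<^sup>2))"

text \<open>This is the derivative of \<open>h b\<close>, expanded.\<close>

definition f :: "bool \<Rightarrow> real \<Rightarrow> complex" where
  "f b y = exp (D b (y\<^sup>2)) * (1 + 2 * complex_of_real (y\<^sup>2) * d b (y\<^sup>2))"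

lemma has_vector_derivative_power2:
  assumes "(g has_vector_derivative g') (at (y\<^sup>2))"
  shows "((\<lambda>y. g (y\<^sup>2)) has_vector_derivative (2 * y) *\<^sub>R g') (at y)"
proof -
  have "((\<lambda>y. y\<^sup>2) has_vector_derivative 2 * y) (at y)"
    unfolding has_real_derivative_iff_has_vector_derivative[symmetric]
    by (auto intro!: derivative_eq_intros)
  from vector_diff_chain_at[OF this assms] show ?thesis by (simp add: o_def)
qed

lemma has_vector_derivative_exp:
  fixes g :: "real \<Rightarrow> complex"
  assumes "(g has_vector_derivative g') (at y)"
  shows "((\<lambda>y. exp (g y)) has_vector_derivative exp (g y) * g') (at y)"
  using field_vector_diff_chain_at[OF assms DERIV_exp] by (simp add: o_def mult.commute)

lemma exp_D_deriv:
  "((\<lambda>y. exp (D b (y\<^sup>2))) has_vector_derivative exp (D b (y\<^sup>2)) * (2 * complex_of_real y * d b (y\<^sup>2))) (at y)"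
  using has_vector_derivative_exp[OF has_vector_derivative_power2[OF D_deriv]]
  by (simp add: scaleR_conv_of_real)

lemma h_deriv: "(h b has_vector_derivative f b y) (at y)"
proof -
  have "((\<lambda>y. complex_of_real y) has_vector_derivative 1) (at y)"
    by (auto intro!: derivative_eq_intros)
  from has_vector_derivative_mult[OF this exp_D_deriv]
  have "((\<lambda>y. y * exp (D b (y\<^sup>2))) has_vector_derivative
      y * (exp (D b (y\<^sup>2)) * (2 * complex_of_real y * d b (y\<^sup>2))) + 1 * exp (D b (y\<^sup>2))) (at y)" .
  then show ?thesis
    unfolding h_def[abs_def] f_def
    by (rule has_vector_derivative_eq_rhs) (simp add: algebra_simps power2_eq_square)
qed

lemma f_cont: "continuous_on UNIV (f b)"
proof (rule continuous_at_imp_continuous_on, rule ballI)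
  fix y
  have d: "isCont (\<lambda>y. d b (y\<^sup>2)) y"
    by (rule isCont_o2[of _ "\<lambda>y. y\<^sup>2"]) (auto intro: d_cont)
  have E: "isCont (\<lambda>y. exp (D b (y\<^sup>2))) y"
    by (rule has_vector_derivative_continuous[OF exp_D_deriv])
  show "isCont (f b) y"
    unfolding f_def[abs_def] by (rule d E | rule continuous_intros)+
qed

text \<open>The last factor is Z = y h'/h - \<gamma>, written in terms of q = y^2.\<close>

lemma generator_eq:
  "y * f b y - \<gamma> * h b y = y * exp (D b (y\<^sup>2)) * (1 - complex_of_real \<gamma> + 2 * complex_of_real (y\<^sup>2) * d b (y\<^sup>2))"
  by (simp add: f_def h_def algebra_simps)

text \<open>Differentiating twice gives h'' = y exp(D) (6 d + 4 q d^2 + 4 q e) with q = y^2. After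
  cancelling y exp(D), \<open>coefficient_eq\<close> is thus the profile equation 2 A h'' = y h' -
  \<gamma> h in the past, and the same with a minus sign in the future.\<close>

lemma f_deriv:
  assumes "y\<^sup>2 \<notin> X b"
  shows "(f b has_vector_derivative
    (if b then 1 else -1) * (y * f b y - \<gamma> * h b y) / (2 * A b (y\<^sup>2))) (at y)"
proof -
  define q where "q = y\<^sup>2"
  define s :: complex where "s = (if b then 1 else -1)"
  have "A b q \<noteq> 0"
    using A_Re(1) A_Re(2)[of q b] by (auto simp: q_def)
  have "((\<lambda>y. y\<^sup>2) has_vector_derivative 2 * y) (at y)"
    unfolding has_real_derivative_iff_has_vector_derivative[symmetric]
    by (auto intro!: derivative_eq_intros)
  from has_vector_derivative_mult_right[OF bounded_linear.has_vector_derivative[OF bounded_linear_of_real this], of 2]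
  have "((\<lambda>y. 2 * complex_of_real (y\<^sup>2)) has_vector_derivative 2 * (2 * complex_of_real y)) (at y)"
    by simp
  from has_vector_derivative_mult[OF this has_vector_derivative_power2[OF d_deriv[OF _ assms]]]
  have "((\<lambda>y. 2 * complex_of_real (y\<^sup>2) * d b (y\<^sup>2)) has_vector_derivative
      2 * complex_of_real q * ((2 * y) *\<^sub>R e b q) + 2 * (2 * complex_of_real y) * d b q) (at y)"
    by (simp add: q_def)
  from has_vector_derivative_mult[OF exp_D_deriv has_vector_derivative_add[OF has_vector_derivative_const this]]
  have "(f b has_vector_derivative exp (D b q) * (0 + (2 * complex_of_real q * ((2 * y) *\<^sub>R e b q) + 2 * (2 * complex_of_real y) * d b q))
      + exp (D b q) * (2 * complex_of_real y * d b q) * (1 + 2 * complex_of_real q * d b q)) (at y)"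
    unfolding f_def[abs_def] q_def .
  moreover have "exp (D b q) * (0 + (2 * complex_of_real q * ((2 * y) *\<^sub>R e b q) + 2 * (2 * complex_of_real y) * d b q))
      + exp (D b q) * (2 * complex_of_real y * d b q) * (1 + 2 * complex_of_real q * d b q)
      = y * exp (D b q) * (6 * d b q + 4 * complex_of_real q * (d b q)\<^sup>2 + 4 * complex_of_real q * e b q)"
    by (simp add: algebra_simps power2_eq_square scaleR_conv_of_real)
  moreover have "s * (y * f b y - \<gamma> * h b y) / (2 * A b q)
      = y * exp (D b q) * (6 * d b q + 4 * complex_of_real q * (d b q)\<^sup>2 + 4 * complex_of_real q * e b q)"
  proof -
    define W where "W = 6 * d b q + 4 * complex_of_real q * (d b q)\<^sup>2 + 4 * complex_of_real q * e b q"
    have eq: "1 - complex_of_real \<gamma> + 2 * complex_of_real q * d b q = s * 2 * A b q * W"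
      using coefficient_eq[of q b] assms by (simp add: q_def s_def W_def)
    have "s * (y * exp (D b q) * (s * 2 * A b q * W)) / (2 * A b q) = (s * s) * (y * exp (D b q) * W)"
      using \<open>A b q \<noteq> 0\<close> by simp
    also have "s * s = 1" by (simp add: s_def)
    finally show ?thesis
      unfolding generator_eq q_def[symmetric] eq W_def[symmetric] by simp
  qed
  ultimately show ?thesis
    unfolding s_def q_def by metis
qed

text \<open>Compactness handles bounded \<open>q\<close>. For large \<open>q\<close> the convergence
  in \<open>D_lim\<close> gives Re D \<le> Re L + 1, because the logarithmic term is nonnegative
  once q \<ge> 1.\<close>

lemma exp_D_bounded: "\<exists>M\<ge>0. \<forall>b. \<forall>q\<ge>0. cmod (exp (D b q)) \<le> M"
proof -
  have "\<exists>M. \<forall>q\<ge>0. cmod (exp (D b q)) \<le> M" for b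
  proof -
    have "\<forall>\<^sub>F q in at_top. dist (D b q + (1 - \<gamma>) / 2 * ln q) L < 1"
      using D_lim by (rule tendstoD) simp
    then obtain R where R: "\<And>q. R \<le> q \<Longrightarrow> dist (D b q + (1 - \<gamma>) / 2 * ln q) L < 1"
      by (auto simp: eventually_at_top_linorder)
    define S where "S = max R 1"
    have "continuous_on {0..S} (D b)"
      using has_vector_derivative_continuous[OF D_deriv]
      by (auto intro!: continuous_at_imp_continuous_on)
    then have "continuous_on {0..S} (\<lambda>q. exp (D b q))"
      by (rule continuous_on_exp)
    then have "bounded ((\<lambda>q. exp (D b q)) ` {0..S})"
      using compact_continuous_image compact_imp_bounded compact_Icc by blast
    then obtain M where "\<forall>z\<in>(\<lambda>q. exp (D b q)) ` {0..S}. cmod z \<le> M"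
      unfolding bounded_iff by blast
    then have M: "cmod (exp (D b q)) \<le> M" if "q \<in> {0..S}" for q
      using that by blast
    have "cmod (exp (D b q)) \<le> max M (exp (Re L + 1))" if "0 \<le> q" for q
    proof (cases "q \<le> S")
      case True
      with that M[of q] show ?thesis by auto
    next
      case False
      then have "R \<le> q" "1 \<le> q" by (auto simp: S_def)
      have "\<bar>Re (D b q + (1 - \<gamma>) / 2 * ln q - L)\<bar> < 1"
        using R[OF \<open>R \<le> q\<close>] abs_Re_le_cmod order.strict_trans1 unfolding dist_norm by blast
      moreover have "0 \<le> (1 - \<gamma>) / 2 * ln q" using \<open>1 \<le> q\<close> \<gamma> by simp
      moreover have "Re (complex_of_real ((1 - \<gamma>) / 2 * ln q)) = (1 - \<gamma>) / 2 * ln q" by simp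
      ultimately have "Re (D b q) \<le> Re L + 1" by simp
      then show ?thesis by (simp add: le_max_iff_disj)
    qed
    then show ?thesis by blast
  qed
  then obtain M where M: "\<And>b q. 0 \<le> q \<Longrightarrow> cmod (exp (D b q)) \<le> M b" by metis
  show ?thesis
  proof (intro exI[of _ "max 0 (max (M True) (M False))"] conjI allI impI)
    show "cmod (exp (D b q)) \<le> max 0 (max (M True) (M False))" if "0 \<le> q" for b q
      using M[OF that, of b] by (cases b) auto
  qed simp
qed

text \<open>For y \<noteq> 0, |y| to the power 1 - \<gamma> is the exponential of ((1 - \<gamma>)/2)
  ln(y^2), the very term that \<open>D_lim\<close> adds to \<open>D\<close>. Oddness of
  \<open>h\<close> produces the sign at minus infinity.\<close>

lemma h_lim:
  "((\<lambda>y. h b y / complex_of_real (\<bar>y\<bar> powr \<gamma>)) \<longlongrightarrow> exp L) at_top"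
  "((\<lambda>y. h b y / complex_of_real (\<bar>y\<bar> powr \<gamma>)) \<longlongrightarrow> - exp L) at_bot"
proof -
  have eq: "h b y / complex_of_real (\<bar>y\<bar> powr \<gamma>) = complex_of_real (sgn y) * exp (D b (y\<^sup>2) + (1 - \<gamma>) / 2 * ln (y\<^sup>2))"
    if "y \<noteq> 0" for y
  proof -
    have "exp ((1 - \<gamma>) / 2 * ln (y\<^sup>2)) = \<bar>y\<bar> powr (1 - \<gamma>)"
      using that by (simp add: powr_def ln_realpow[of "\<bar>y\<bar>" 2, simplified])
    also have "\<dots> = \<bar>y\<bar> / \<bar>y\<bar> powr \<gamma>"
      using that by (simp add: powr_diff)
    finally have "exp (complex_of_real ((1 - \<gamma>) / 2 * ln (y\<^sup>2))) = complex_of_real (\<bar>y\<bar> / \<bar>y\<bar> powr \<gamma>)"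
      by (metis exp_of_real)
    then have "exp (D b (y\<^sup>2) + (1 - \<gamma>) / 2 * ln (y\<^sup>2)) = exp (D b (y\<^sup>2)) * complex_of_real (\<bar>y\<bar> / \<bar>y\<bar> powr \<gamma>)"
      by (simp only: exp_add of_real_mult)
    moreover have "sgn y * (\<bar>y\<bar> / \<bar>y\<bar> powr \<gamma>) = y / \<bar>y\<bar> powr \<gamma>"
      by (simp add: sgn_mult_abs)
    then have "complex_of_real (y / \<bar>y\<bar> powr \<gamma>) = complex_of_real (sgn y) * complex_of_real (\<bar>y\<bar> / \<bar>y\<bar> powr \<gamma>)"
      by (metis of_real_mult)
    moreover have "h b y / complex_of_real (\<bar>y\<bar> powr \<gamma>) = complex_of_real (y / \<bar>y\<bar> powr \<gamma>) * exp (D b (y\<^sup>2))"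
      by (simp add: h_def)
    ultimately show ?thesis
      by (simp only: mult.assoc mult.commute[of "exp _"])
  qed
  have lim: "((\<lambda>y. exp (D b (y\<^sup>2) + (1 - \<gamma>) / 2 * ln (y\<^sup>2))) \<longlongrightarrow> exp L) F"
    if "filterlim (\<lambda>y::real. y\<^sup>2) at_top F" for F
    using filterlim_compose[OF D_lim that] by (intro tendsto_exp) simp
  have "filterlim (\<lambda>y::real. y\<^sup>2) at_top at_top" "filterlim (\<lambda>y::real. y\<^sup>2) at_top at_bot"
    by (simp_all add: filterlim_pow_at_top filterlim_pow_at_bot_even filterlim_ident)
  note lims = this[THEN lim]
  have "\<forall>\<^sub>F y in at_top. exp (D b (y\<^sup>2) + (1 - \<gamma>) / 2 * ln (y\<^sup>2)) = h b y / complex_of_real (\<bar>y\<bar> powr \<gamma>)"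
    using eventually_gt_at_top[of 0] by eventually_elim (subst eq, simp_all)
  from Lim_transform_eventually[OF lims(1) this]
  show "((\<lambda>y. h b y / complex_of_real (\<bar>y\<bar> powr \<gamma>)) \<longlongrightarrow> exp L) at_top" .
  have "\<forall>\<^sub>F y in at_bot. - exp (D b (y\<^sup>2) + (1 - \<gamma>) / 2 * ln (y\<^sup>2)) = h b y / complex_of_real (\<bar>y\<bar> powr \<gamma>)"
    using eventually_gt_at_bot[of 0] by eventually_elim (subst eq, simp_all)
  from Lim_transform_eventually[OF tendsto_minus[OF lims(2)] this]
  show "((\<lambda>y. h b y / complex_of_real (\<bar>y\<bar> powr \<gamma>)) \<longlongrightarrow> - exp L) at_bot" .
qed

lemma self_similar: "\<exists>K'. self_similar_profile \<gamma> c K' (exp L) h f (\<lambda>b y. A b (y\<^sup>2)) (\<lambda>b. {y. y\<^sup>2 \<in> X b})"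
proof -
  obtain M where M: "0 \<le> M" "\<And>b q. 0 \<le> q \<Longrightarrow> cmod (exp (D b q)) \<le> M"
    using exp_D_bounded by blast
  have "0 \<le> K" using A_bdd[of 0 True] norm_ge_zero order_trans by blast
  \<comment> \<open>The summands bound, in turn, the coefficient, \<open>f\<close>, and the weighted
    expression y f - \<gamma> h; the factor 2 comes from (1 + |y|)|y| \<le> 2(1 + y^2).\<close>
  define K' where "K' = K + M * (1 + K) + 2 * M * K"
  have K': "K \<le> K'" "M * (1 + K) \<le> K'" "2 * M * K \<le> K'"
    using M \<open>0 \<le> K\<close> by (auto simp: K'_def)
  have G: "cmod (1 - complex_of_real \<gamma> + 2 * complex_of_real q * d b q) \<le> K / (1 + q)" if "0 \<le> q" for b q
    using d_bdd[OF that, of b] that by (simp add: field_simps)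
  have "self_similar_profile \<gamma> c K' (exp L) h f (\<lambda>b y. A b (y\<^sup>2)) (\<lambda>b. {y. y\<^sup>2 \<in> X b})"
  proof
    show "finite {y. y\<^sup>2 \<in> X b}" for b
    proof (rule finite_subset)
      show "{y. y\<^sup>2 \<in> X b} \<subseteq> sqrt ` X b \<union> uminus ` sqrt ` X b"
      proof
        fix y assume "y \<in> {y. y\<^sup>2 \<in> X b}"
        then have "sqrt (y\<^sup>2) \<in> sqrt ` X b" by blast
        moreover have "y = sqrt (y\<^sup>2) \<or> y = - sqrt (y\<^sup>2)" by (simp add: abs_if)
        ultimately show "y \<in> sqrt ` X b \<union> uminus ` sqrt ` X b" by (metis UnI1 UnI2 imageI)
      qed
    qed (simp add: X_finite)
    show "(\<lambda>y. A b (y\<^sup>2)) \<in> borel_measurable borel" for b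
      by (rule measurable_compose[OF _ A_borel]) simp
    show "cmod (f b y) \<le> K'" for b y
    proof -
      have "cmod (1 + 2 * complex_of_real (y\<^sup>2) * d b (y\<^sup>2)) \<le> cmod (1 - complex_of_real \<gamma> + 2 * complex_of_real (y\<^sup>2) * d b (y\<^sup>2)) + cmod \<gamma>"
        using norm_triangle_ineq[of "1 - complex_of_real \<gamma> + 2 * complex_of_real (y\<^sup>2) * d b (y\<^sup>2)" "complex_of_real \<gamma>"] by simp
      also have "\<dots> \<le> K / (1 + y\<^sup>2) + 1"
        using G[of "y\<^sup>2" b] \<gamma> by (intro add_mono) auto
      also have "K / (1 + y\<^sup>2) \<le> K / 1" using \<open>0 \<le> K\<close> by (intro divide_left_mono) (auto intro: add_pos_nonneg)
      finally have "cmod (1 + 2 * complex_of_real (y\<^sup>2) * d b (y\<^sup>2)) \<le> 1 + K" by simp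
      then have "cmod (f b y) \<le> M * (1 + K)"
        unfolding f_def norm_mult[of "exp _"] using M by (intro mult_mono) auto
      with K' show ?thesis by simp
    qed
    show "(1 + \<bar>y\<bar>) * cmod (y * f b y - \<gamma> * h b y) \<le> K'" for b y
    proof -
      have "(1 + \<bar>y\<bar>) * cmod (y * f b y - \<gamma> * h b y) =
          (1 + \<bar>y\<bar>) * \<bar>y\<bar> * cmod (exp (D b (y\<^sup>2))) * cmod (1 - complex_of_real \<gamma> + 2 * complex_of_real (y\<^sup>2) * d b (y\<^sup>2))"
        by (simp add: generator_eq norm_mult)
      also have "\<dots> \<le> (1 + \<bar>y\<bar>) * \<bar>y\<bar> * M * (K / (1 + y\<^sup>2))"
        using M G[of "y\<^sup>2" b] by (intro mult_mono mult_left_mono mult_nonneg_nonneg) auto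
      also have "(1 + \<bar>y\<bar>) * \<bar>y\<bar> \<le> 2 * (1 + y\<^sup>2)"
      proof -
        have "\<bar>y\<bar> \<le> 1 + y\<^sup>2"
          using zero_le_power2[of "\<bar>y\<bar> - 1/2"] by (simp add: power2_eq_square algebra_simps)
        then show ?thesis by (simp add: algebra_simps power2_eq_square)
      qed
      then have "(1 + \<bar>y\<bar>) * \<bar>y\<bar> * M * (K / (1 + y\<^sup>2)) \<le> 2 * (1 + y\<^sup>2) * M * (K / (1 + y\<^sup>2))"
        using M \<open>0 \<le> K\<close> by (intro mult_right_mono) auto
      also have "\<dots> = 2 * M * K"
        using add_pos_nonneg[of 1 "y\<^sup>2"] by (simp add: field_simps)
      finally show ?thesis using K' by simp
    qed
    show "cmod (A b (y\<^sup>2)) \<le> K'" for b y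
      using A_bdd[of "y\<^sup>2" b] K' by simp
  qed (use \<gamma> A_Re h_deriv f_cont f_deriv h_lim in \<open>auto simp: h_def\<close>)
  then show ?thesis ..
qed

text \<open>This provides the lower bound required for the blow-up: while \<open>D\<close> is linear
  with real slope m \<ge> 0, both factors of \<open>f\<close> are real and at least 1.\<close>

lemma f_eq_0_to_1:
  assumes "0 \<le> m" "\<And>q. \<lbrakk>0 \<le> q; q \<le> 1\<rbrakk> \<Longrightarrow> D b q = complex_of_real (m * q) \<and> d b q = complex_of_real m"
    and "\<bar>y\<bar> \<le> 1"
  shows "1 \<le> cmod (f b y)"
proof -
  have "y\<^sup>2 \<le> 1" using assms(3) by (simp add: abs_square_le_1)
  then have D: "D b (y\<^sup>2) = complex_of_real (m * y\<^sup>2)" "d b (y\<^sup>2) = complex_of_real m"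
    using assms(2)[of "y\<^sup>2"] by simp_all
  have "f b y = complex_of_real (exp (m * y\<^sup>2) * (1 + 2 * y\<^sup>2 * m))"
    unfolding f_def D exp_of_real by simp
  moreover have "1 * 1 \<le> exp (m * y\<^sup>2) * (1 + 2 * y\<^sup>2 * m)"
    using assms(1) by (intro mult_mono) auto
  ultimately show ?thesis by (simp only: norm_of_real)
qed

end

section \<open>The spiral profile in the past\<close>

text \<open>Starting the integral at -1 makes 0 an interior point, so the derivative there is
  two-sided, as the profile requires.\<close>

lemma antiderivative_past_minus_one:
  fixes d :: "real \<Rightarrow> complex"
  assumes "continuous_on UNIV d" "- 1 < q"
  shows "((\<lambda>q. integral {- 1..q} d) has_vector_derivative d q) (at q)"
proof -
  have "((\<lambda>q. integral {- 1..q} d) has_vector_derivative d q) (at q within {- 1..q + 1})"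
    by (rule integral_has_vector_derivative) (use assms continuous_on_subset in auto)
  then show ?thesis
    using at_within_Icc_at[of "- 1" q "q + 1"] assms(2) by simp
qed

lemma has_vector_derivative_max_0:
  assumes "s \<noteq> (c :: real)"
  shows "((\<lambda>s. max 0 (s - c)) has_vector_derivative (if c < s then 1 else 0)) (at s)"
proof (cases "c < s")
  case True
  show ?thesis
  proof (rule has_vector_derivative_transform_within_open)
    show "((\<lambda>s. s - c) has_vector_derivative (if c < s then 1 else 0)) (at s)"
      using True by (auto intro!: derivative_eq_intros)
    show "open {c<..}" "s \<in> {c<..}" using True by auto
  qed auto
next
  case False
  show ?thesis
  proof (rule has_vector_derivative_transform_within_open)
    show "((\<lambda>s. 0) has_vector_derivative (if c < s then 1 else 0)) (at s)"
      using False by simp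
    show "open {..<c}" "s \<in> {..<c}" using False assms by auto
  qed auto
qed

text \<open>Since Re(1/N) = Re N / |N|^2, a lower bound on Re N and an upper bound on |N| together
  give accretivity and boundedness of q/(2N) for \<open>q\<close> in a bounded range.\<close>

lemma Re_quotient_bounds:
  assumes "0 < m" "m \<le> Re N" "cmod N \<le> M" "1 \<le> q" "q \<le> R"
  shows "m / (2 * M\<^sup>2) \<le> Re (complex_of_real q / (2 * N))"
    and "cmod (complex_of_real q / (2 * N)) \<le> R / (2 * m)"
proof -
  have N: "m \<le> cmod N" using assms complex_Re_le_cmod[of N] by simp
  then have pos: "0 < cmod N" using assms(1) by linarith
  have "N \<noteq> 0" using pos by auto
  then have "complex_of_real q / (2 * N) = complex_of_real (q / 2 / (cmod N)\<^sup>2) * cnj N"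
    unfolding of_real_divide complex_norm_square by simp
  then have "Re (complex_of_real q / (2 * N)) = q / 2 * (Re N / (cmod N)\<^sup>2)"
    by (simp only: Re_complex_of_real complex_mult_cnj times_complex.sel Im_complex_of_real cnj.sel) simp
  moreover have "m / M\<^sup>2 \<le> Re N / (cmod N)\<^sup>2"
    using assms pos by (intro frac_le power_mono) auto
  moreover have "1 / 2 * (m / M\<^sup>2) \<le> q / 2 * (Re N / (cmod N)\<^sup>2)"
    using assms calculation(2) by (intro mult_mono) auto
  ultimately show "m / (2 * M\<^sup>2) \<le> Re (complex_of_real q / (2 * N))" by simp
  show "cmod (complex_of_real q / (2 * N)) \<le> R / (2 * m)"
    using assms N by (simp add: norm_divide norm_mult frac_le)
qed

text \<open>
  In terms of \<open>Z = 1 - \<gamma> + 2 q d\<close> and \<open>s = ln q\<close> the coefficient is \<open>A = q / (2 N)\<close> with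
  \<open>N = 2 Z'/Z + \<delta> + Z - \<gamma> (1 - \<gamma>) / Z\<close>, where \<open>\<delta> = 2 \<gamma> - 1\<close>. Starting at \<open>Z = 1/2\<close>, the curve \<open>Z\<close>
  turns by half a circle, then shrinks at a small rate \<open>\<kappa>\<close> until \<open>\<gamma> (1 - \<gamma>) / \<bar>Z\<bar>\<close> dominates \<open>N\<close>, and
  then shrinks like \<open>1 / q\<close>, which makes \<open>A\<close> bounded.
\<close>
locale spiral =
  fixes \<delta> :: real
  assumes \<delta>: "0 < \<delta>" "\<delta> < 1"
begin

text \<open>This is \<gamma>(1 - \<gamma>) for \<gamma> = (1 + \<delta>)/2.\<close>

definition g :: real where "g = (1 - \<delta>\<^sup>2) / 4"
text \<open>Shrinking at rate \<kappa> costs 2\<kappa> = \<delta>/4 in Re N, little enough to leave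
  Re N \<ge> \<delta>/4.\<close>

definition \<kappa> :: real where "\<kappa> = \<delta> / 8"
text \<open>At this moment |Z| has shrunk from 1/2 to g/5. Then g/|Z| = 5, enough to outweigh the -2
  that 2 Z'/Z contributes once Z shrinks at rate 1.\<close>

definition s1 :: real where "s1 = pi + ln (5 / (2 * g)) / \<kappa>"

text \<open>A logarithm of 2 Z: piecewise linear, with slope i up to \<pi>, -\<kappa> up to
  \<open>s1\<close>, and -1 afterwards.\<close>

definition \<Xi> :: "real \<Rightarrow> complex" where
  "\<Xi> s = \<i> * complex_of_real s - (\<kappa> + \<i>) * complex_of_real (max 0 (s - pi))
    - complex_of_real ((1 - \<kappa>) * max 0 (s - s1))"

text \<open>The slope of \<open>\<Xi>\<close>, that is Z'/Z away from the two break points.\<close>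

definition \<zeta> :: "real \<Rightarrow> complex" where
  "\<zeta> s = \<i> - (\<kappa> + \<i>) * (if pi < s then 1 else 0) - complex_of_real ((1 - \<kappa>) * (if s1 < s then 1 else 0))"

definition Z :: "real \<Rightarrow> complex" where "Z s = exp (\<Xi> s) / 2"

definition d' :: "real \<Rightarrow> complex" where
  "d' q = (Z (ln q) - complex_of_real ((1 - \<delta>) / 2)) / complex_of_real (2 * q)"

text \<open>Above 1 this solves Z = 1 - \<gamma> + 2 q d for \<open>d\<close>. Freezing it below 1
  avoids the logarithm near 0: \<open>d\<close> is the constant \<delta>/4 there, and 1 - \<gamma> +
  2 q d rises linearly from 1 - \<gamma> at q = 0 to 1/2 at q = 1.\<close>

definition d :: "real \<Rightarrow> complex" where "d q = d' (max q 1)"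

definition e :: "real \<Rightarrow> complex" where
  "e q = (if q < 1 then 0 else (\<zeta> (ln q) * Z (ln q) - (Z (ln q) - complex_of_real ((1 - \<delta>) / 2))) / complex_of_real (2 * q\<^sup>2))"

text \<open>The subtracted constant is the integral of \<open>d\<close> over [-1, 0], so that
  \<open>D 0 = 0\<close>.\<close>

definition D :: "real \<Rightarrow> complex" where
  "D q = integral {- 1..q} d - complex_of_real (\<delta> / 4)"

definition N :: "real \<Rightarrow> complex" where
  "N s = 2 * \<zeta> s + \<delta> + Z s - g / Z s"

text \<open>The branch q \<le> 1 is the coefficient equation solved for d = \<delta>/4 and e =
  0.\<close>

definition A :: "real \<Rightarrow> complex" where
  "A q = (if q \<le> 1 then complex_of_real (((1 - \<delta>) / 2 + \<delta> / 2 * q) / (\<delta> * (3 + \<delta> / 2 * q)))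
    else complex_of_real q / (2 * N (ln q)))"

lemma g: "0 < g" "g < 1/4"
  using \<delta> power_strict_mono[of \<delta> 1 2] by (auto simp: g_def)

lemma \<kappa>: "0 < \<kappa>" "\<kappa> < 1"
  using \<delta> by (auto simp: \<kappa>_def)

lemma s1_gt: "pi < s1"
proof -
  have "1 < 5 / (2 * g)" using g by (simp add: field_simps)
  then have "0 < ln (5 / (2 * g)) / \<kappa>" using \<kappa> by (intro divide_pos_pos ln_gt_zero)
  then show ?thesis by (simp add: s1_def)
qed

lemma exp_s1_gt: "1 < exp s1"
  using s1_gt pi_gt_zero by (simp add: less_trans[of 0 pi s1])

lemma exp_s1: "exp (- (\<kappa> * (s1 - pi))) = 2 * g / 5"
  using \<kappa> g by (simp add: s1_def exp_minus)

lemma Z_eq1: "s \<le> pi \<Longrightarrow> Z s = cis s / 2"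
  using s1_gt by (simp add: Z_def \<Xi>_def cis_conv_exp)

lemma Z_eq2:
  assumes "pi \<le> s" "s \<le> s1"
  shows "Z s = - complex_of_real (exp (- (\<kappa> * (s - pi))) / 2)"
proof -
  have "\<Xi> s = \<i> * complex_of_real pi + complex_of_real (- (\<kappa> * (s - pi)))"
    using assms by (simp add: \<Xi>_def algebra_simps)
  then show ?thesis
    by (simp only: Z_def exp_add[of "\<i> * _"] exp_of_real exp_pi_i') simp
qed

lemma Z_eq3:
  assumes "s1 \<le> s"
  shows "Z s = - complex_of_real (g / 5 * exp (s1 - s))"
proof -
  have "\<Xi> s = \<i> * complex_of_real pi + complex_of_real (- (\<kappa> * (s1 - pi)) + (s1 - s))"
    using assms s1_gt by (simp add: \<Xi>_def algebra_simps)
  then have "Z s = - complex_of_real (exp (- (\<kappa> * (s1 - pi)) + (s1 - s))) / 2"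
    by (simp only: Z_def exp_add[of "\<i> * _"] exp_of_real exp_pi_i') simp
  also have "\<dots> = - complex_of_real (g / 5 * exp (s1 - s))"
    unfolding exp_add exp_s1 by simp
  finally show ?thesis .
qed

lemma Z_nonzero: "Z s \<noteq> 0"
  by (simp add: Z_def)

lemma Z_le_half:
  shows "cmod (Z s) \<le> 1/2"
proof -
  have "Re (\<Xi> s) = - (\<kappa> * max 0 (s - pi)) - (1 - \<kappa>) * max 0 (s - s1)"
    by (simp add: \<Xi>_def)
  also have "\<dots> \<le> 0"
  proof -
    have "0 \<le> \<kappa> * max 0 (s - pi)" "0 \<le> (1 - \<kappa>) * max 0 (s - s1)" using \<kappa> by auto
    then show ?thesis by linarith
  qed
  finally show ?thesis by (simp add: Z_def norm_divide)
qed

lemma Z_deriv: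
  assumes "s \<noteq> pi" "s \<noteq> s1"
  shows "(Z has_vector_derivative \<zeta> s * Z s) (at s)"
proof -
  note max_deriv = bounded_linear.has_vector_derivative[OF bounded_linear_of_real has_vector_derivative_max_0]
  have "((\<lambda>s. complex_of_real s) has_vector_derivative 1) (at s)"
    by (auto intro!: derivative_eq_intros)
  then have "(\<Xi> has_vector_derivative \<i> * 1
      - (\<kappa> + \<i>) * complex_of_real (if pi < s then 1 else 0)
      - complex_of_real (1 - \<kappa>) * complex_of_real (if s1 < s then 1 else 0)) (at s)"
    unfolding \<Xi>_def[abs_def] of_real_mult
    by (intro has_vector_derivative_diff has_vector_derivative_mult_right max_deriv assms)
  then have "(\<Xi> has_vector_derivative \<zeta> s) (at s)"
    by (rule has_vector_derivative_eq_rhs) (simp add: \<zeta>_def)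
  from field_vector_diff_chain_at[OF this DERIV_exp]
  have "((\<lambda>s. exp (\<Xi> s)) has_vector_derivative \<zeta> s * exp (\<Xi> s)) (at s)" by (simp add: o_def)
  from has_vector_derivative_divide[OF this, of 2] show ?thesis
    unfolding Z_def[abs_def] by simp
qed

lemma continuous_on_Z: "continuous_on UNIV Z"
  unfolding Z_def \<Xi>_def by (intro continuous_intros) auto

lemma continuous_on_d: "continuous_on UNIV d"
proof -
  have "continuous_on UNIV (\<lambda>q. Z (ln (max q 1)))"
    by (rule continuous_on_compose2[OF continuous_on_Z]) (auto intro!: continuous_intros)
  then show ?thesis
    unfolding d_def d'_def by (intro continuous_intros) auto
qed

lemma d_le_1: "q \<le> 1 \<Longrightarrow> d q = complex_of_real (\<delta> / 4)"
proof -
  assume "q \<le> 1"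
  then have "d q = (1 / 2 - complex_of_real ((1 - \<delta>) / 2)) / 2"
    using Z_eq1[of 0] by (simp add: d_def d'_def max_absorb2)
  also have "\<dots> = complex_of_real ((1 / 2 - (1 - \<delta>) / 2) / 2)"
    by simp
  also have "(1 / 2 - (1 - \<delta>) / 2) / 2 = \<delta> / 4" by (simp add: field_simps)
  finally show ?thesis .
qed

lemma D_deriv: "0 \<le> q \<Longrightarrow> (D has_vector_derivative d q) (at q)"
  using has_vector_derivative_diff_const[THEN iffD2, OF antiderivative_past_minus_one[OF continuous_on_d]]
  unfolding D_def[abs_def] by simp

lemma D_le_1:
  assumes "0 \<le> q" "q \<le> 1"
  shows "D q = complex_of_real (\<delta> / 4 * q)"
proof -
  have "integral {- 1..q} d = integral {- 1..q} (\<lambda>_. complex_of_real (\<delta> / 4))"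
    using assms by (intro integral_cong d_le_1) auto
  also have "\<dots> = complex_of_real ((q + 1) * (\<delta> / 4))"
    using assms by (simp add: scaleR_conv_of_real)
  finally show ?thesis by (simp add: D_def algebra_simps)
qed

lemma two_q_d: "1 \<le> q \<Longrightarrow> 2 * complex_of_real q * d q = Z (ln q) - complex_of_real ((1 - \<delta>) / 2)"
  by (simp add: d_def d'_def max_absorb1)

lemma d_deriv:
  assumes "0 \<le> q" "q \<notin> {1, exp pi, exp s1}"
  shows "(d has_vector_derivative e q) (at q)"
proof (cases "q < 1")
  case True
  have "((\<lambda>q. complex_of_real (\<delta> / 4)) has_vector_derivative e q) (at q)"
    using True by (simp add: e_def)
  then show ?thesis
    by (rule has_vector_derivative_transform_within_open[where S = "{..<1}"]) (use True d_le_1 in auto)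
next
  case False
  with assms have q: "1 < q" by simp
  have ln: "ln q \<noteq> pi" "ln q \<noteq> s1"
    using assms q by (metis exp_ln insertCI less_trans zero_less_one)+
  have "(ln has_vector_derivative 1 / q) (at q)"
    unfolding has_real_derivative_iff_has_vector_derivative[symmetric]
    using q by (auto intro!: derivative_eq_intros)
  from vector_diff_chain_at[OF this Z_deriv[OF ln]]
  have "((\<lambda>q. Z (ln q) - complex_of_real ((1 - \<delta>) / 2)) has_vector_derivative
      (1 / q) *\<^sub>R (\<zeta> (ln q) * Z (ln q))) (at q)"
    by (simp add: o_def has_vector_derivative_diff_const)
  moreover have "((\<lambda>q. 1 / (2 * q)) has_vector_derivative - 1 / (2 * q\<^sup>2)) (at q)"
    unfolding has_real_derivative_iff_has_vector_derivative[symmetric]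
    using q by (auto intro!: derivative_eq_intros simp: field_simps power2_eq_square)
  then have "((\<lambda>q. complex_of_real (1 / (2 * q))) has_vector_derivative complex_of_real (- 1 / (2 * q\<^sup>2))) (at q)"
    by (rule bounded_linear.has_vector_derivative[OF bounded_linear_of_real])
  ultimately have "((\<lambda>q. (Z (ln q) - complex_of_real ((1 - \<delta>) / 2)) * complex_of_real (1 / (2 * q))) has_vector_derivative
      (Z (ln q) - complex_of_real ((1 - \<delta>) / 2)) * complex_of_real (- 1 / (2 * q\<^sup>2)) +
      (1 / q) *\<^sub>R (\<zeta> (ln q) * Z (ln q)) * complex_of_real (1 / (2 * q))) (at q)"
    by (rule has_vector_derivative_mult)
  moreover have "(Z (ln q) - complex_of_real ((1 - \<delta>) / 2)) * complex_of_real (- 1 / (2 * q\<^sup>2)) +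
      (1 / q) *\<^sub>R (\<zeta> (ln q) * Z (ln q)) * complex_of_real (1 / (2 * q)) = e q"
    using q by (simp add: e_def scaleR_conv_of_real divide_simps power2_eq_square)
  ultimately have "((\<lambda>q. (Z (ln q) - complex_of_real ((1 - \<delta>) / 2)) * complex_of_real (1 / (2 * q)))
      has_vector_derivative e q) (at q)" by simp
  then show ?thesis
    by (rule has_vector_derivative_transform_within_open[where S = "{1<..}"])
      (use q in \<open>auto simp: d_def d'_def max_absorb1\<close>)
qed

text \<open>The terms of N are at most 2, 1, 1/2 and 5 in modulus, the last because |Z| \<ge> g/5 up
  to \<open>s1\<close>; 12 is a generous total. For the real part, the turn and the slow shrinking
  are treated separately.\<close>

lemma N_bound:
  assumes "s \<le> s1"
  shows "\<delta> / 4 \<le> Re (N s)" "cmod (N s) \<le> 12"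
proof -
  have Z_ge: "g / 5 \<le> cmod (Z s)"
  proof (cases "s \<le> pi")
    case True
    then show ?thesis using g by (simp add: Z_eq1 norm_divide)
  next
    case False
    have "exp (- (\<kappa> * (s1 - pi))) \<le> exp (- (\<kappa> * (s - pi)))"
      using \<kappa> assms by (simp add: mult_left_mono)
    then show ?thesis
      using False assms by (simp add: Z_eq2 exp_s1)
  qed
  have "cmod (\<zeta> s) \<le> 1"
    using assms \<kappa> by (auto simp: \<zeta>_def)
  moreover have "cmod (g / Z s) \<le> 5"
    using g Z_ge Z_nonzero[of s] by (simp add: norm_divide field_simps)
  moreover have "cmod (2 * \<zeta> s) = 2 * cmod (\<zeta> s)" "cmod (complex_of_real \<delta>) = \<delta>"
    using \<delta> by (simp_all add: norm_mult)
  moreover have "cmod (N s) \<le> cmod (2 * \<zeta> s + \<delta> + Z s) + cmod (g / Z s)"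
    unfolding N_def by (rule norm_triangle_ineq4)
  moreover have "cmod (2 * \<zeta> s + \<delta> + Z s) \<le> cmod (2 * \<zeta> s + \<delta>) + cmod (Z s)"
    by (rule norm_triangle_ineq)
  moreover have "cmod (2 * \<zeta> s + \<delta>) \<le> cmod (2 * \<zeta> s) + cmod (complex_of_real \<delta>)"
    by (rule norm_triangle_ineq)
  ultimately show "cmod (N s) \<le> 12"
    using Z_le_half[of s] \<delta> by linarith
  have \<delta>2: "\<delta>\<^sup>2 \<le> \<delta>"
    using \<delta> mult_left_mono[of \<delta> 1 \<delta>] by (simp add: power2_eq_square)
  have g2: "2 * g = 1 / 2 - \<delta>\<^sup>2 / 2" by (simp add: g_def)
  have Re_N: "Re (N s) = 2 * Re (\<zeta> s) + \<delta> + Re (Z s) - Re (g / Z s)"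
    by (simp add: N_def)
  show "\<delta> / 4 \<le> Re (N s)"
  proof (cases "s \<le> pi")
    case True
    \<comment> \<open>On the circle |Z| = 1/2 this yields Re(Z - g/Z) = (1/2 - 2g) cos s, and 1/2 -
      2g = \<delta>^2/2.\<close>
    have "g / Z s = complex_of_real (2 * g) * cis (- s)"
      unfolding Z_eq1[OF True] divide_inverse inverse_mult_distrib cis_inverse by simp
    then have "Re (g / Z s) = (1 / 2 - \<delta>\<^sup>2 / 2) * cos s"
      unfolding g2 by (simp only: times_complex.sel cis.sel Re_complex_of_real Im_complex_of_real) simp
    moreover have "Re (Z s) = cos s / 2" using True by (simp add: Z_eq1)
    moreover have "\<zeta> s = \<i>" using True s1_gt by (simp add: \<zeta>_def)
    ultimately have "Re (N s) = \<delta> + \<delta>\<^sup>2 / 2 * cos s"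
      unfolding Re_N by (simp add: algebra_simps)
    moreover have "\<delta>\<^sup>2 / 2 * - 1 \<le> \<delta>\<^sup>2 / 2 * cos s"
      by (rule mult_left_mono) simp_all
    ultimately show ?thesis using \<delta> \<delta>2 by linarith
  next
    case False
    \<comment> \<open>Now Z = -z, and -z + g/z is smallest at z = 1/2, where Re N = 3\<delta>/4 -
      \<delta>^2/2 \<ge> \<delta>/4.\<close>
    define z where "z = exp (- (\<kappa> * (s - pi))) / 2"
    have Zz: "Z s = - complex_of_real z" using Z_eq2[of s] False assms by (simp add: z_def)
    have "0 \<le> \<kappa> * (s - pi)" using False \<kappa> by simp
    then have z: "0 < z" "z \<le> 1/2" by (simp_all add: z_def)
    have "\<zeta> s = - complex_of_real \<kappa>" using False assms by (simp add: \<zeta>_def)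
    then have "Re (N s) = - 2 * \<kappa> + \<delta> - z + g / z"
      unfolding Re_N Zz by simp
    moreover have "g / (1/2) \<le> g / z" using g z by (intro divide_left_mono) auto
    ultimately show ?thesis using z \<delta> \<delta>2 g2 by (simp add: \<kappa>_def)
  qed
qed

text \<open>Here g/|Z| = 5 exp(s - s1), while the remaining terms sum to a negative number above
  -2.5. Hence N is real and comparable to exp(s - s1), which keeps q/(2N) bounded as
  \<open>q\<close> grows.\<close>

lemma N_tail:
  assumes "s1 < s"
  obtains n where "N s = complex_of_real n" "5 / 2 * exp (s - s1) \<le> n" "n \<le> 5 * exp (s - s1)"
proof -
  define z where "z = g / 5 * exp (s1 - s)"
  have Zz: "Z s = - complex_of_real z" using assms by (simp add: z_def Z_eq3)
  define n where "n = - 2 + \<delta> - z + g / z"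
  have "exp (s1 - s) \<le> 1" using assms by simp
  then have "z \<le> g / 5 * 1" unfolding z_def using g by (intro mult_left_mono) auto
  then have z: "z \<le> 1 / 20" using g by simp
  have "0 < z" using g by (simp add: z_def)
  have gz: "g / z = 5 * exp (s - s1)"
    using g by (simp add: z_def exp_diff)
  have "1 \<le> exp (s - s1)" using assms by simp
  then have "5 / 2 * exp (s - s1) \<le> n" "n \<le> 5 * exp (s - s1)"
    unfolding n_def gz using z \<open>0 < z\<close> \<delta> by linarith+
  moreover have "N s = complex_of_real n"
    using assms s1_gt by (simp add: N_def \<zeta>_def Zz n_def algebra_simps)
  ultimately show ?thesis by (rule that[rotated])
qed

text \<open>For q > 1 put \<beta> = 1 - \<gamma>, so that 2 q d = Z - \<beta> and g = \<beta>(1 -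
  \<beta>). Multiplying the bracket by \<open>q\<close> gives (Z - \<beta>)(1 + Z - \<beta>) + 2
  \<zeta> Z = Z N, so A = q/(2N) leaves exactly Z.\<close>

lemma coefficient_eq:
  assumes "0 \<le> q" "q \<notin> {1, exp pi, exp s1}"
  shows "2 * A q * (6 * d q + 4 * complex_of_real q * (d q)\<^sup>2 + 4 * complex_of_real q * e q)
    = complex_of_real ((1 - \<delta>) / 2) + 2 * complex_of_real q * d q"
proof (cases "q < 1")
  case True
  define A' where "A' = ((1 - \<delta>) / 2 + \<delta> / 2 * q) / (\<delta> * (3 + \<delta> / 2 * q))"
  have "0 \<le> \<delta> / 2 * q" using assms \<delta> by simp
  then have "\<delta> * (3 + \<delta> / 2 * q) \<noteq> 0" using \<delta> by simp
  then have "2 * A' * (6 * (\<delta> / 4) + 4 * q * (\<delta> / 4)\<^sup>2) = (1 - \<delta>) / 2 + 2 * q * (\<delta> / 4)"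
    unfolding A'_def by (simp add: divide_simps power2_eq_square) (simp add: algebra_simps)
  then have "complex_of_real (2 * A' * (6 * (\<delta> / 4) + 4 * q * (\<delta> / 4)\<^sup>2)) =
      complex_of_real ((1 - \<delta>) / 2 + 2 * q * (\<delta> / 4))" by (rule arg_cong)
  moreover have "A q = complex_of_real A'" using True by (simp add: A_def A'_def)
  ultimately show ?thesis
    using True by (simp add: d_le_1 e_def)
next
  case False
  with assms have q: "1 < q" by simp
  define z where "z = Z (ln q)"
  define \<beta> where "\<beta> = complex_of_real ((1 - \<delta>) / 2)"
  define w where "w = \<zeta> (ln q)"
  have "z \<noteq> 0" by (simp add: z_def Z_nonzero)
  have "g = (1 - \<delta>) / 2 * (1 - (1 - \<delta>) / 2)"
    by (simp add: g_def field_simps power2_eq_square)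
  then have g_eq: "complex_of_real g = \<beta> * (1 - \<beta>)"
    by (simp only: \<beta>_def of_real_mult of_real_diff of_real_1)
  have \<delta>_eq: "complex_of_real \<delta> = 1 - 2 * \<beta>" by (simp add: \<beta>_def field_simps)
  have "ln q \<le> s1 \<or> s1 < ln q" by linarith
  then have "N (ln q) \<noteq> 0"
  proof
    assume "ln q \<le> s1"
    then show ?thesis using N_bound(1)[of "ln q"] \<delta> by auto
  next
    assume *: "s1 < ln q"
    then obtain n where "N (ln q) = complex_of_real n" "5 / 2 * exp (ln q - s1) \<le> n"
      using N_tail by blast
    moreover have "0 < 5 / 2 * exp (ln q - s1)" by simp
    ultimately show ?thesis by (metis less_le_not_le of_real_eq_0_iff)
  qed
  have qd: "2 * complex_of_real q * d q = z - \<beta>"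
    using two_q_d[of q] q by (simp add: z_def \<beta>_def)
  have "complex_of_real q * (6 * d q + 4 * complex_of_real q * (d q)\<^sup>2 + 4 * complex_of_real q * e q) =
      3 * (2 * complex_of_real q * d q) + (2 * complex_of_real q * d q)\<^sup>2 + 4 * (complex_of_real q)\<^sup>2 * e q"
    by (simp add: algebra_simps power2_eq_square)
  also have "4 * (complex_of_real q)\<^sup>2 * e q = 2 * (w * z - (z - \<beta>))"
    using q by (simp add: e_def w_def z_def \<beta>_def)
  also have "3 * (2 * complex_of_real q * d q) + (2 * complex_of_real q * d q)\<^sup>2 + 2 * (w * z - (z - \<beta>)) = z * N (ln q)"
    unfolding qd N_def w_def[symmetric] z_def[symmetric] g_eq \<delta>_eq
    using \<open>z \<noteq> 0\<close> by (simp add: field_simps power2_eq_square)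
  finally have eq: "complex_of_real q * (6 * d q + 4 * complex_of_real q * (d q)\<^sup>2 + 4 * complex_of_real q * e q) = z * N (ln q)" .
  have "2 * A q * (6 * d q + 4 * complex_of_real q * (d q)\<^sup>2 + 4 * complex_of_real q * e q) =
      complex_of_real q * (6 * d q + 4 * complex_of_real q * (d q)\<^sup>2 + 4 * complex_of_real q * e q) / N (ln q)"
    using q by (simp add: A_def)
  also have "\<dots> = z" unfolding eq using \<open>N (ln q) \<noteq> 0\<close> by simp
  finally show ?thesis
    unfolding qd \<beta>_def by simp
qed

lemma A_bounds: "\<exists>c>0. \<exists>M. \<forall>q\<ge>0. c \<le> Re (A q) \<and> cmod (A q) \<le> M"
proof -
  define a1 b1 where "a1 = ((1 - \<delta>) / 2) / (\<delta> * (3 + \<delta> / 2))" and "b1 = (1 / 2) / (\<delta> * 3)"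
  define a2 b2 where "a2 = (\<delta> / 4) / (2 * 12\<^sup>2)" and "b2 = exp s1 / (2 * (\<delta> / 4))"
  define a3 b3 where "a3 = exp s1 / 10" and "b3 = exp s1 / 5"
  have pos: "0 < min a1 (min a2 a3)"
    using \<delta> by (simp add: a1_def a2_def a3_def)
  have "min a1 (min a2 a3) \<le> Re (A q) \<and> cmod (A q) \<le> max b1 (max b2 b3)" if "0 \<le> q" for q
  proof -
    consider "q \<le> 1" | "1 < q" "ln q \<le> s1" | "1 < q" "s1 < ln q" by linarith
    then show ?thesis
    proof cases
      case 1
      define A' where "A' = ((1 - \<delta>) / 2 + \<delta> / 2 * q) / (\<delta> * (3 + \<delta> / 2 * q))"
      have A: "A q = complex_of_real A'" using 1 by (simp add: A_def A'_def)
      have x: "0 \<le> \<delta> / 2 * q" "\<delta> / 2 * q \<le> \<delta> / 2"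
        using that 1 \<delta> mult_left_mono[of q 1 "\<delta> / 2"] by auto
      have "a1 \<le> A'"
        unfolding a1_def A'_def using x \<delta> by (intro frac_le mult_left_mono mult_pos_pos) auto
      moreover have "A' \<le> b1"
        unfolding b1_def A'_def using x \<delta> by (intro frac_le mult_left_mono mult_pos_pos) (auto simp: field_simps)
      moreover have "0 \<le> a1" using \<delta> by (simp add: a1_def)
      ultimately show ?thesis unfolding A by auto
    next
      case 2
      then have "q \<le> exp s1" by (metis exp_le_cancel_iff exp_ln less_trans zero_less_one)
      with Re_quotient_bounds[OF _ N_bound[OF 2(2)], of q "exp s1"] 2 \<delta> show ?thesis
        by (auto simp: A_def a2_def b2_def)
    next
      case 3
      then obtain n where n: "N (ln q) = complex_of_real n" "5 / 2 * exp (ln q - s1) \<le> n" "n \<le> 5 * exp (ln q - s1)"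
        using N_tail by blast
      have e: "exp (ln q - s1) = q / exp s1" using 3 by (simp add: exp_diff)
      have n': "5 * q \<le> 2 * n * exp s1" "n * exp s1 \<le> 5 * q"
        using n(2,3) unfolding e by (auto simp: field_simps)
      then have "0 < n * exp s1" using 3 by simp
      then have "0 < n" by (simp add: zero_less_mult_iff)
      then have "a3 \<le> q / (2 * n)" "q / (2 * n) \<le> b3"
        using n' unfolding a3_def b3_def by (auto simp: field_simps)
      moreover have "A q = complex_of_real (q / (2 * n))" using 3 by (simp add: A_def n)
      moreover have "0 < q / (2 * n)" using 3 \<open>0 < n\<close> by simp
      moreover have "cmod (A q) = q / (2 * n)"
        using calculation by (simp only: norm_of_real abs_of_pos)
      ultimately show ?thesis by auto
    qed
  qed
  with pos show ?thesis by blast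
qed

lemma measurable_A: "A \<in> borel_measurable borel"
proof -
  have [measurable]: "Z \<in> borel_measurable borel"
    by (rule borel_measurable_continuous_onI[OF continuous_on_Z])
  have [measurable]: "\<zeta> \<in> borel_measurable borel"
    unfolding \<zeta>_def[abs_def] by measurable
  have [measurable]: "N \<in> borel_measurable borel"
    unfolding N_def[abs_def] by measurable
  show ?thesis
    unfolding A_def[abs_def] by measurable
qed

text \<open>Beyond \<open>exp s1\<close> the function \<open>d\<close> equals -(1 - \<delta>)/(4q) -
  R/(2q^2), so \<open>G\<close>, which removes the explicit antiderivative, is constant there and
  \<open>D\<close> has the required logarithmic asymptotics.\<close>

lemma D_lim: "\<exists>L. ((\<lambda>q. D q + (1 - \<delta>) / 4 * ln q) \<longlongrightarrow> L) at_top"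
proof -
  define R where "R = g / 5 * exp s1"
  define G where "G q = D q + complex_of_real ((1 - \<delta>) / 4 * ln q - R / (2 * q))" for q
  have q_ge: "1 < q" "s1 \<le> ln q" if "exp s1 \<le> q" for q
  proof -
    show "1 < q" by (rule order.strict_trans2[OF exp_s1_gt that])
    with that show "s1 \<le> ln q" by (simp add: ln_ge_iff)
  qed
  have G0: "(G has_vector_derivative 0) (at q)" if "exp s1 \<le> q" for q
  proof -
    note q = q_ge[OF that]
    have "((\<lambda>q. (1 - \<delta>) / 4 * ln q - R / (2 * q)) has_vector_derivative (1 - \<delta>) / (4 * q) + R / (2 * q\<^sup>2)) (at q)"
      unfolding has_real_derivative_iff_has_vector_derivative[symmetric]
      using q by (auto intro!: derivative_eq_intros simp: field_simps power2_eq_square)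
    from has_vector_derivative_add[OF D_deriv bounded_linear.has_vector_derivative[OF bounded_linear_of_real this]]
    have "(G has_vector_derivative d q + complex_of_real ((1 - \<delta>) / (4 * q) + R / (2 * q\<^sup>2))) (at q)"
      using q unfolding G_def[abs_def] by simp
    moreover have "d q = complex_of_real (- ((1 - \<delta>) / (4 * q) + R / (2 * q\<^sup>2)))"
    proof -
      have "exp (s1 - ln q) = exp s1 / q" using q by (simp add: exp_diff)
      then have "d q = complex_of_real ((- (g / 5 * (exp s1 / q)) - (1 - \<delta>) / 2) / (2 * q))"
        using q by (simp add: d_def d'_def max_absorb1 Z_eq3)
      also have "(- (g / 5 * (exp s1 / q)) - (1 - \<delta>) / 2) / (2 * q) = - ((1 - \<delta>) / (4 * q) + R / (2 * q\<^sup>2))"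
        using q by (simp add: R_def field_simps power2_eq_square)
      finally show ?thesis .
    qed
    ultimately show ?thesis by simp
  qed
  have "(G has_vector_derivative 0) (at q within {exp s1..})" if "q \<in> {exp s1..}" for q
    by (rule has_vector_derivative_at_within[OF G0]) (use that in simp)
  with convex_real_interval(1) obtain L where "\<And>q. q \<in> {exp s1..} \<Longrightarrow> G q = L"
    by (rule has_vector_derivative_zero_constant) blast+
  then have L: "G q = L" if "exp s1 \<le> q" for q
    using that by simp
  have "((\<lambda>q. R / (2 * q)) \<longlongrightarrow> 0) at_top"
    by (rule tendsto_divide_0[OF tendsto_const])
      (intro filterlim_at_top_imp_at_infinity filterlim_tendsto_pos_mult_at_top[OF tendsto_const] filterlim_ident, simp)
  then have "((\<lambda>q. L + complex_of_real (R / (2 * q))) \<longlongrightarrow> L + complex_of_real 0) at_top"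
    by (intro tendsto_intros)
  moreover have "\<forall>\<^sub>F q in at_top. L + complex_of_real (R / (2 * q)) = D q + (1 - \<delta>) / 4 * ln q"
    using eventually_ge_at_top[of "exp s1"]
    by eventually_elim (simp add: L[symmetric] G_def)
  ultimately have "((\<lambda>q. D q + (1 - \<delta>) / 4 * ln q) \<longlongrightarrow> L + complex_of_real 0) at_top"
    by (rule Lim_transform_eventually)
  then show ?thesis by blast
qed

text \<open>For q \<ge> 1 the expression inside the modulus is \<open>Z (ln q)\<close>; its final
  decay like 1/q balances the factor 1 + q. On the remaining bounded range the modulus is at most
  1.\<close>

lemma d_bound: "\<exists>M. \<forall>q\<ge>0. (1 + q) * cmod (complex_of_real ((1 - \<delta>) / 2) + 2 * complex_of_real q * d q) \<le> M"
proof -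
  have "(1 + q) * cmod (complex_of_real ((1 - \<delta>) / 2) + 2 * complex_of_real q * d q) \<le> 2 * exp s1" if "0 \<le> q" for q
  proof -
    note es = exp_s1_gt
    consider "q \<le> 1" | "1 < q" "q \<le> exp s1" | "1 < q" "exp s1 < q" by linarith
    then show ?thesis
    proof cases
      case 1
      have \<delta>q: "\<delta> * q \<le> \<delta> * 1" using 1 \<delta> by (intro mult_left_mono) auto
      have "0 \<le> (1 - \<delta>) / 2 + \<delta> * q / 2" using that \<delta> by simp
      moreover have "complex_of_real ((1 - \<delta>) / 2) + 2 * complex_of_real q * d q = complex_of_real ((1 - \<delta>) / 2 + \<delta> * q / 2)"
        using 1 by (simp add: d_le_1)
      ultimately have "cmod (complex_of_real ((1 - \<delta>) / 2) + 2 * complex_of_real q * d q) = (1 - \<delta>) / 2 + \<delta> * q / 2"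
        by (simp only: norm_of_real abs_of_nonneg)
      moreover have "(1 - \<delta>) / 2 + \<delta> * q / 2 \<le> (1 - \<delta>) / 2 + \<delta> * 1 / 2"
        by (intro add_left_mono divide_right_mono \<delta>q) simp
      then have "(1 - \<delta>) / 2 + \<delta> * q / 2 \<le> 1"
        by (rule order.trans) (use \<delta> in \<open>simp add: field_simps\<close>)
      ultimately have "cmod (complex_of_real ((1 - \<delta>) / 2) + 2 * complex_of_real q * d q) \<le> 1" by metis
      then have "(1 + q) * cmod (complex_of_real ((1 - \<delta>) / 2) + 2 * complex_of_real q * d q) \<le> 2 * 1"
        using that 1 by (intro mult_mono) auto
      also have "\<dots> \<le> 2 * exp s1" using es by linarith
      finally show ?thesis .
    next
      case 2
      then have "cmod (complex_of_real ((1 - \<delta>) / 2) + 2 * complex_of_real q * d q) \<le> 1 / 2"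
        using Z_le_half by (simp add: two_q_d)
      then have "(1 + q) * cmod (complex_of_real ((1 - \<delta>) / 2) + 2 * complex_of_real q * d q) \<le> (1 + exp s1) * 1"
        using 2 by (intro mult_mono) auto
      also have "\<dots> \<le> 2 * exp s1"
        unfolding mult_1_right mult_2 by (rule add_right_mono[OF less_imp_le[OF es]])
      finally show ?thesis .
    next
      case 3
      then have "s1 \<le> ln q" by (simp add: ln_ge_iff)
      then have "cmod (complex_of_real ((1 - \<delta>) / 2) + 2 * complex_of_real q * d q) = g / 5 * (exp s1 / q)"
        using 3 g by (simp add: two_q_d Z_eq3 exp_diff norm_mult norm_divide)
      also have "\<dots> \<le> 1 * (exp s1 / q)" using g 3 by (intro mult_right_mono) auto
      finally have "(1 + q) * cmod (complex_of_real ((1 - \<delta>) / 2) + 2 * complex_of_real q * d q) \<le> (2 * q) * (exp s1 / q)"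
        using 3 by (intro mult_mono) auto
      with 3 show ?thesis by simp
    qed
  qed
  then show ?thesis by blast
qed

section \<open>The future profile and its matching with the past\<close>

definition \<gamma> :: real where "\<gamma> = (1 + \<delta>) / 2"

text \<open>Matching the value at \<open>t = 0\<close>, the future profile is \<open>h y = exp L * y * (1 + y\<^sup>2) powr ((\<gamma> - 1) / 2)\<close>.\<close>
definition future_D :: "complex \<Rightarrow> real \<Rightarrow> complex" where
  "future_D L q = L + complex_of_real (- ((1 - \<gamma>) / 2) * ln (1 + q))"

definition future_d :: "real \<Rightarrow> complex" where
  "future_d q = complex_of_real (- ((1 - \<gamma>) / 2) / (1 + q))"

definition future_e :: "real \<Rightarrow> complex" where
  "future_e q = complex_of_real ((1 - \<gamma>) / 2 / (1 + q)\<^sup>2)"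

text \<open>Solved from the profile equation: here Z = (1 - \<gamma>)/(1 + q) and 6 d + 4 q d^2 + 4
  q e = -(1 - \<gamma>)(3 + \<gamma> q)/(1 + q)^2, whose negative sign is absorbed by the sign of
  the future equation.\<close>

definition future_A :: "real \<Rightarrow> complex" where
  "future_A q = complex_of_real ((1 + q) / (2 * (3 + \<gamma> * q)))"

lemma \<gamma>: "1/2 < \<gamma>" "\<gamma> < 1"
  using \<delta> by (auto simp: \<gamma>_def)

lemma one_minus_\<gamma>: "1 - \<gamma> = (1 - \<delta>) / 2"
  by (simp add: \<gamma>_def field_simps)

lemma future_D_deriv:
  assumes "0 \<le> q"
  shows "(future_D L has_vector_derivative future_d q) (at q)"
proof -
  have "((\<lambda>q. - k * ln (1 + q)) has_vector_derivative - k / (1 + q)) (at q)" for k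
    unfolding has_real_derivative_iff_has_vector_derivative[symmetric]
    using assms by (auto intro!: derivative_eq_intros)
  from has_vector_derivative_add[OF has_vector_derivative_const
      bounded_linear.has_vector_derivative[OF bounded_linear_of_real this]]
  show ?thesis
    unfolding future_D_def[abs_def] future_d_def add_0 .
qed

lemma future_d_deriv:
  assumes "0 \<le> q"
  shows "(future_d has_vector_derivative future_e q) (at q)"
proof -
  have "((\<lambda>q. - k / (1 + q)) has_vector_derivative k / (1 + q)\<^sup>2) (at q)" for k
    unfolding has_real_derivative_iff_has_vector_derivative[symmetric]
    using assms by (auto intro!: derivative_eq_intros simp: power2_eq_square divide_simps)
  from bounded_linear.has_vector_derivative[OF bounded_linear_of_real this]
  show ?thesis
    unfolding future_d_def[abs_def] future_e_def .
qed

lemma future_generator: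
  assumes "0 \<le> q"
  shows "1 - complex_of_real \<gamma> + 2 * complex_of_real q * future_d q = complex_of_real ((1 - \<gamma>) / (1 + q))"
proof -
  have "1 - \<gamma> + 2 * q * (- ((1 - \<gamma>) / 2) / (1 + q)) = (1 - \<gamma>) / (1 + q)"
    using assms by (simp add: field_simps)
  from arg_cong[OF this, of complex_of_real] show ?thesis
    by (simp only: future_d_def of_real_add of_real_diff of_real_mult of_real_1 of_real_numeral)
qed

lemma future_coefficient_eq:
  assumes "0 \<le> q"
  shows "- 1 * 2 * future_A q * (6 * future_d q + 4 * complex_of_real q * (future_d q)\<^sup>2 + 4 * complex_of_real q * future_e q)
    = 1 - complex_of_real \<gamma> + 2 * complex_of_real q * future_d q"
proof -
  define r where "r = 1 + q"
  define k where "k = 3 + \<gamma> * q"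
  define b where "b = 1 - \<gamma>"
  have r: "0 < r" using assms by (simp add: r_def)
  have "0 \<le> \<gamma> * q" using assms \<gamma> by simp
  then have k: "0 < k" by (simp add: k_def)
  have eq: "6 * (- (b / 2) / r) + 4 * q * (- (b / 2) / r)\<^sup>2 + 4 * q * (b / 2 / r\<^sup>2) = - b * k / r\<^sup>2"
    using r by (simp add: divide_simps power2_eq_square) (simp add: r_def b_def k_def algebra_simps)
  have "- 1 * 2 * (r / (2 * k)) * (6 * (- (b / 2) / r) + 4 * q * (- (b / 2) / r)\<^sup>2 + 4 * q * (b / 2 / r\<^sup>2)) = b / r"
    unfolding eq using r k by (simp add: power2_eq_square)
  from arg_cong[OF this, of complex_of_real] show ?thesis
    unfolding future_generator[OF assms]
    by (simp only: future_A_def future_d_def future_e_def r_def b_def k_def of_real_add of_real_mult of_real_power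
        of_real_minus of_real_1 of_real_numeral)
qed

lemma future_A_bounds:
  assumes "0 \<le> q"
  shows "1/6 \<le> Re (future_A q)" "cmod (future_A q) \<le> 1"
proof -
  define m where "m = \<gamma> * q"
  have "q / 2 \<le> m" "m \<le> q"
    using assms \<gamma> mult_right_mono[of "1/2" \<gamma> q] mult_right_mono[of \<gamma> 1 q] by (auto simp: m_def)
  then have "1/6 \<le> (1 + q) / (2 * (3 + m))" "0 \<le> (1 + q) / (2 * (3 + m))" "(1 + q) / (2 * (3 + m)) \<le> 1"
    using assms by (auto simp: divide_simps)
  then show "1/6 \<le> Re (future_A q)" "cmod (future_A q) \<le> 1"
    by (simp_all only: future_A_def m_def[symmetric] Re_complex_of_real norm_of_real abs_of_nonneg)
qed

lemma future_D_lim: "((\<lambda>q. future_D L q + complex_of_real ((1 - \<gamma>) / 2 * ln q)) \<longlongrightarrow> L) at_top"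
proof -
  have "((\<lambda>q::real. 1 / q) \<longlongrightarrow> 0) at_top"
    by (rule tendsto_divide_0[OF tendsto_const filterlim_at_top_imp_at_infinity[OF filterlim_ident]])
  then have "((\<lambda>q::real. ln (1 + 1 / q)) \<longlongrightarrow> ln (1 + 0)) at_top"
    by (intro tendsto_intros) simp_all
  moreover have "\<forall>\<^sub>F q::real in at_top. ln (1 + 1 / q) = ln (1 + q) - ln q"
    using eventually_gt_at_top[of 0]
  proof eventually_elim
    case (elim q)
    then have "1 + 1 / q = (1 + q) / q" by (simp add: field_simps)
    with elim show ?case by (simp add: ln_div)
  qed
  ultimately have "((\<lambda>q::real. ln (1 + q) - ln q) \<longlongrightarrow> ln (1 + 0)) at_top"
    by (rule Lim_transform_eventually)
  then have "((\<lambda>q::real. ln (1 + q) - ln q) \<longlongrightarrow> 0) at_top" by simp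
  then have "((\<lambda>q. L + complex_of_real (- ((1 - \<gamma>) / 2) * (ln (1 + q) - ln q))) \<longlongrightarrow>
      L + complex_of_real (- ((1 - \<gamma>) / 2) * 0)) at_top"
    by (intro tendsto_intros)
  moreover have "L + complex_of_real (- ((1 - \<gamma>) / 2) * (ln (1 + q) - ln q)) =
      future_D L q + complex_of_real ((1 - \<gamma>) / 2 * ln q)" for q
  proof -
    have "- ((1 - \<gamma>) / 2) * (ln (1 + q) - ln q) = - ((1 - \<gamma>) / 2) * ln (1 + q) + (1 - \<gamma>) / 2 * ln q"
      by (simp only: right_diff_distrib)
    then show ?thesis
      unfolding future_D_def by (simp only: of_real_add add.assoc)
  qed
  ultimately show ?thesis by simp
qed

lemma profile:
  obtains c K L where "exponential_profile \<gamma> c K L (\<lambda>b. if b then D else future_D L)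
    (\<lambda>b. if b then d else future_d) (\<lambda>b. if b then e else future_e) (\<lambda>b. if b then A else future_A)
    (\<lambda>b. if b then {1, exp pi, exp s1} else {})"
proof -
  obtain c M1 where A: "0 < c" "\<And>q. 0 \<le> q \<Longrightarrow> c \<le> Re (A q)" "\<And>q. 0 \<le> q \<Longrightarrow> cmod (A q) \<le> M1"
    using A_bounds by blast
  obtain M2 where d: "\<And>q. 0 \<le> q \<Longrightarrow>
      (1 + q) * cmod (complex_of_real ((1 - \<delta>) / 2) + 2 * complex_of_real q * d q) \<le> M2"
    using d_bound by blast
  \<comment> \<open>The past dictates the constant. The future profile can be multiplied by any
    complex number, hence by \<open>exp L\<close>.\<close>
  obtain L where L: "((\<lambda>q. D q + complex_of_real ((1 - \<delta>) / 4 * ln q)) \<longlongrightarrow> L) at_top"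
    using D_lim by blast
  define K where "K = max 1 (max M1 M2)"
  have K: "1 \<le> K" "M1 \<le> K" "M2 \<le> K" by (auto simp: K_def)
  have \<beta>: "complex_of_real ((1 - \<delta>) / 2) = 1 - complex_of_real \<gamma>"
    unfolding one_minus_\<gamma>[symmetric] by simp
  have "exponential_profile \<gamma> (min c (1/6)) K L (\<lambda>b. if b then D else future_D L)
    (\<lambda>b. if b then d else future_d) (\<lambda>b. if b then e else future_e) (\<lambda>b. if b then A else future_A)
    (\<lambda>b. if b then {1, exp pi, exp s1} else {})"
  proof
    fix q :: real and b :: bool
    show "1/2 < \<gamma>" "\<gamma> < 1" by (fact \<gamma>)+
    show "finite (if b then {1, exp pi, exp s1} else {})" by simp
    show "0 < min c (1/6)" using A(1) by simp
    show "(if b then A else future_A) \<in> borel_measurable borel"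
    proof (cases b)
      case True
      then show ?thesis using measurable_A by simp
    next
      case False
      have "future_A \<in> borel_measurable borel" unfolding future_A_def[abs_def] by measurable
      then show ?thesis using False by simp
    qed
    show "((\<lambda>q. (if b then D else future_D L) q + complex_of_real ((1 - \<gamma>) / 2 * ln q)) \<longlongrightarrow> L) at_top"
    proof (cases b)
      case True
      have eq: "(1 - \<gamma>) / 2 = (1 - \<delta>) / 4" by (simp add: one_minus_\<gamma>)
      show ?thesis unfolding eq using True L by simp
    next
      case False
      then show ?thesis using future_D_lim by simp
    qed
    assume q: "0 \<le> q"
    show "((if b then D else future_D L) has_vector_derivative (if b then d else future_d) q) (at q)"
      using D_deriv[OF q] future_D_deriv[OF q] by (cases b) simp_all
    show "isCont (if b then d else future_d) q"
      using continuous_on_d has_vector_derivative_continuous[OF future_d_deriv[OF q]]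
      by (cases b) (simp_all add: continuous_on_eq_continuous_at)
    show "min c (1/6) \<le> Re ((if b then A else future_A) q)"
      using A(2)[OF q] future_A_bounds(1)[OF q] by (cases b) simp_all
    show "cmod ((if b then A else future_A) q) \<le> K"
      using A(3)[OF q] future_A_bounds(2)[OF q] K by (cases b) simp_all
    show "(1 + q) * cmod (1 - complex_of_real \<gamma> + 2 * complex_of_real q * (if b then d else future_d) q) \<le> K"
    proof (cases b)
      case True
      then show ?thesis using d[OF q] K unfolding \<beta> by simp
    next
      case False
      have "(1 + q) * cmod (complex_of_real ((1 - \<gamma>) / (1 + q))) = 1 - \<gamma>"
        unfolding norm_of_real using q \<gamma> by (simp add: abs_of_nonneg)
      then show ?thesis using False K \<gamma> by (simp only: if_False future_generator[OF q])
    qed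
    assume X: "q \<notin> (if b then {1, exp pi, exp s1} else {})"
    show "((if b then d else future_d) has_vector_derivative (if b then e else future_e) q) (at q)"
      using d_deriv[OF q] future_d_deriv[OF q] X by (cases b) simp_all
    show "(if b then 1 else - 1) * 2 * (if b then A else future_A) q *
        (6 * (if b then d else future_d) q + 4 * complex_of_real q * ((if b then d else future_d) q)\<^sup>2 +
         4 * complex_of_real q * (if b then e else future_e) q) =
        1 - complex_of_real \<gamma> + 2 * complex_of_real q * (if b then d else future_d) q"
    proof (cases b)
      case True
      with X have "q \<notin> {1, exp pi, exp s1}" by simp
      from coefficient_eq[OF q this] show ?thesis
        using True unfolding \<beta> by (simp only: if_True mult_1_left)
    next
      case False
      then show ?thesis using future_coefficient_eq[OF q] by (simp only: if_False)
    qed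
  qed
  then show ?thesis by (rule that)
qed

end

theorem theorem1p4:
  fixes p :: real
  assumes "p > 6"
  shows "\<exists>a u :: real \<times> real \<Rightarrow> complex.
           bounded (range a) \<and> a \<in> borel_measurable lebesgue \<and> strictly_accretive a \<and>
           solution_in_plane a u \<and>
           (\<forall>\<epsilon>. 0 < \<epsilon> \<and> \<epsilon> < 1 \<longrightarrow>
              (\<integral>\<^sup>+z\<in>par_cyl \<epsilon> 0 0. ennreal (cmod (u z) powr p) \<partial>lebesgue) = \<infinity>)"
proof -
  \<comment> \<open>This is \<delta> = 2\<gamma> - 1 for \<gamma> = 1 - 3/p; it is positive
    precisely because p > 6.\<close>
  interpret spiral "1 - 6 / p"
    using assms by unfold_locales (auto simp: field_simps)
  have \<gamma>_p: "p * (1 - \<gamma>) = 3"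
    using assms by (simp add: one_minus_\<gamma>)
  obtain c K L where "exponential_profile \<gamma> c K L (\<lambda>b. if b then D else future_D L)
    (\<lambda>b. if b then d else future_d) (\<lambda>b. if b then e else future_e) (\<lambda>b. if b then A else future_A)
    (\<lambda>b. if b then {1, exp pi, exp s1} else {})"
    by (rule profile)
  then interpret E: exponential_profile \<gamma> c K L "\<lambda>b. if b then D else future_D L"
    "\<lambda>b. if b then d else future_d" "\<lambda>b. if b then e else future_e" "\<lambda>b. if b then A else future_A"
    "\<lambda>b. if b then {1, exp pi, exp s1} else {}" .
  obtain K' where "self_similar_profile \<gamma> c K' (exp L) E.h E.f (\<lambda>b y. (if b then A else future_A) (y\<^sup>2))
    (\<lambda>b. {y. y\<^sup>2 \<in> (if b then {1, exp pi, exp s1} else {})})"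
    using E.self_similar by blast
  then interpret S: self_similar_profile \<gamma> c K' "exp L" E.h E.f "\<lambda>b y. (if b then A else future_A) (y\<^sup>2)"
    "\<lambda>b. {y. y\<^sup>2 \<in> (if b then {1, exp pi, exp s1} else {})}" .
  have "1 \<le> cmod (E.f True y)" if "\<bar>y\<bar> \<le> 1" for y
    \<comment> \<open>The slope of \<open>D\<close> on [0, 1] is \<delta>/4.\<close>
    using \<delta> D_le_1 d_le_1 by (intro E.f_eq_0_to_1[OF _ _ that, of "(1 - 6 / p) / 4"]) auto
  then have "(\<integral>\<^sup>+z\<in>par_cyl \<epsilon> 0 0. ennreal (cmod (S.u z) powr p) \<partial>lebesgue) = \<infinity>" if "0 < \<epsilon>" for \<epsilon>
    using that assms by (intro S.blowup[OF \<gamma>_p]) auto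
  then show ?thesis
    using S.coefficient S.solution by blast
qed

end
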